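(* Let $i\in\{0,1\}$ and let $G$ be a $(3,i)$-saturated subcubic graph such that $g_3(G)=3$. Then: (1) if $i=0$, $G$ is $(1,1,2,4)$-packing colorable; (2) if $i=1$, $G$ is $(1,1,2,3)$-packing colorable.
   Context: All graphs are finite, simple and undirected. For a non-decreasing sequence $S=(s_1,\dots,s_k)$ of positive integers, an $S$-packing coloring of $G$ is a partition of $V(G)$ into sets $V_1,\dots,V_k$ such that any two distinct vertices $u,v\in V_i$ satisfy $dist_G(u,v)>s_i$; $G$ is $S$-packing colorable if it admits one. $G$ is subcubic if its maximum degree is at most $3$. In a subcubic graph, a vertex of degree $3$ is heavy if all its neighbors have degree $3$. A subcubic graph is $(3,k)$-saturated ($0\le k\le 3$) if each heavy vertex is adjacent to at most $k$ heavy vertices. The local girth $g(v)$ of a vertex $v$ is the length of a shortest cycle containing $v$ ($\infty$ if none), and $g_3(G)=\max\{g(v): d_G(v)=3\}$. *)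

theory Defs
  imports
    "Graph_Theory.Pair_Digraph"
    "Graph_Theory.Shortest_Path"
    "HOL-Library.Extended_Nat"
    "HOL-Library.Disjoint_Sets"
begin

text \<open>
  A finite simple undirected graph is a \<open>pair_graph\<close>: an edge \<open>{u, v}\<close> is represented by
  the two arcs \<open>(u, v)\<close> and \<open>(v, u)\<close>, so the degree of a vertex is its out-degree.
\<close>

abbreviation degree :: "'a pair_pre_digraph \<Rightarrow> 'a \<Rightarrow> nat" where
  "degree G v \<equiv> out_degree (with_proj G) v"

definition subcubic :: "'a pair_pre_digraph \<Rightarrow> bool" where
  "subcubic G \<longleftrightarrow> (\<forall>v\<in>pverts G. degree G v \<le> 3)"

definition heavy :: "'a pair_pre_digraph \<Rightarrow> 'a \<Rightarrow> bool" where
  "heavy G v \<longleftrightarrow> v \<in> pverts G \<and> degree G v = 3 \<and> (\<forall>u. (v, u) \<in> parcs G \<longrightarrow> degree G u = 3)"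

text \<open>\<open>saturated3 G k\<close> is \<open>(3,k)\<close>-saturation.\<close>

definition saturated3 :: "'a pair_pre_digraph \<Rightarrow> nat \<Rightarrow> bool" where
  "saturated3 G k \<longleftrightarrow>
     subcubic G \<and> (\<forall>v. heavy G v \<longrightarrow> card {u. (v, u) \<in> parcs G \<and> heavy G u} \<le> k)"

text \<open>
  The library's \<open>cycle\<close> is a directed one, so it also admits \<open>[(u, v), (v, u)]\<close>; the cycles
  of the undirected graph are those of length at least 3. The vertices of a cycle are the tails
  of its arcs. The infimum of the empty set is \<open>\<infinity>\<close>.
\<close>

definition local_girth :: "'a pair_pre_digraph \<Rightarrow> 'a \<Rightarrow> enat" where
  "local_girth G v =
     (INF p \<in> {p. pre_digraph.cycle (with_proj G) p \<and> 3 \<le> length p \<and> v \<in> fst ` set p}.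
        enat (length p))"

text \<open>
  The supremum is over a finite set, hence a maximum. It is \<open>0\<close> if there is no vertex of
  degree 3.
\<close>

definition g3 :: "'a pair_pre_digraph \<Rightarrow> enat" where
  "g3 G = (SUP v \<in> {v \<in> pverts G. degree G v = 3}. local_girth G v)"

text \<open>Distance as shortest-path cost with unit weights; \<open>\<infinity>\<close> if there is no path.\<close>

definition graph_dist :: "'a pair_pre_digraph \<Rightarrow> 'a \<Rightarrow> 'a \<Rightarrow> ereal" where
  "graph_dist G u v = wf_digraph.\<mu> (with_proj G) (\<lambda>_. 1) u v"

text \<open>Colour classes are indexed from 0 and may be empty.\<close>

definition packing_coloring :: "'a pair_pre_digraph \<Rightarrow> nat list \<Rightarrow> (nat \<Rightarrow> 'a set) \<Rightarrow> bool" where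
  "packing_coloring G S V \<longleftrightarrow>
     (\<Union>j<length S. V j) = pverts G \<and> disjoint_family_on V {..<length S} \<and>
     (\<forall>j<length S. \<forall>u\<in>V j. \<forall>v\<in>V j. u \<noteq> v \<longrightarrow> graph_dist G u v > ereal (real (S ! j)))"

definition packing_colorable :: "'a pair_pre_digraph \<Rightarrow> nat list \<Rightarrow> bool" where
  "packing_colorable G S \<longleftrightarrow> (\<exists>V. packing_coloring G S V)"

end

theory Submission
  imports Defs
begin

text \<open>
  Call a vertex inner if each of its edges lies in a triangle with it, and call a triangle open if
  none of its vertices is inner; every vertex of degree 3 then lies in the closed neighbourhood of
  an inner vertex or in an open triangle. A vertex of an open triangle is low if its outer neighbour
  has degree at most 2. The class of distance more than 2 consists of one inner vertex per maximal
  closed neighbourhood and of a maximal choice of low vertices, at most one per open triangle and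
  with distinct outer neighbours. An injective choice, possible because every outer neighbour
  of degree at most 2 serves at most two triangles, selects a low vertex in every open triangle that
  has two of them. The remaining open triangles occur only for \<open>i = 1\<close>; each has
  two heavy vertices, whose outer neighbours lie in triangles with a vertex of degree 2, and
  the same choice principle selects one heavy vertex per triangle with distinct such
  neighbouring triangles. These go to the last class.

  What is left has maximum degree 2. One vertex of each of its odd cycles goes to the last class and
  the rest is 2-colourable. An odd cycle can be left only through the third class, and no
  vertex of that class is adjacent to two odd cycles, so selected vertices on different odd cycles
  have distance at least 5.
\<close>

section \<open>An injective choice principle\<close>

text \<open>Hall's condition holds: \<open>k\<close> elements of \<open>A\<close> own at least
  \<open>2k\<close> darts, and each value of \<beta> takes at most two of them. The proof is greedy:
  the value used for one element costs at most one dart of at most one other element, which is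
  served next.\<close>

lemma injective_dart_choice:
  fixes A :: "'t set" and D :: "'d set" and \<tau> :: "'d \<Rightarrow> 't" and \<beta> :: "'d \<Rightarrow> 'b"
  assumes "finite A"
    and two: "\<And>a. a \<in> A \<Longrightarrow> \<exists>d\<in>D. \<exists>e\<in>D. d \<noteq> e \<and> \<tau> d = a \<and> \<tau> e = a"
    and le2: "\<And>d e f. \<lbrakk>d \<in> D; e \<in> D; f \<in> D; \<beta> d = \<beta> e; \<beta> e = \<beta> f\<rbrakk> \<Longrightarrow> d = e \<or> e = f \<or> d = f"
  shows "\<exists>c. (\<forall>a\<in>A. c a \<in> D \<and> \<tau> (c a) = a) \<and> inj_on (\<beta> \<circ> c) A"
proof -
  text \<open>Strengthened for the induction: one exceptional \<open>a0\<close> may own just one dart.\<close>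
  have gen: "\<exists>c. (\<forall>a\<in>A. c a \<in> D \<and> \<tau> (c a) = a) \<and> inj_on (\<beta> \<circ> c) A"
    if "finite A" "A = {} \<or> (\<exists>a0\<in>A. (\<exists>d\<in>D. \<tau> d = a0) \<and>
          (\<forall>a\<in>A - {a0}. \<exists>d\<in>D. \<exists>e\<in>D. d \<noteq> e \<and> \<tau> d = a \<and> \<tau> e = a))"
      "\<forall>d\<in>D. \<forall>e\<in>D. \<forall>f\<in>D. \<beta> d = \<beta> e \<longrightarrow> \<beta> e = \<beta> f \<longrightarrow> d = e \<or> e = f \<or> d = f" for A D
    using that
  proof (induction "card A" arbitrary: A D)
    case 0
    then show ?case by simp
  next
    case (Suc n)
    then obtain a0 d0 where a0: "a0 \<in> A" "d0 \<in> D" "\<tau> d0 = a0"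
      and oth: "\<And>a. a \<in> A - {a0} \<Longrightarrow> \<exists>d\<in>D. \<exists>e\<in>D. d \<noteq> e \<and> \<tau> d = a \<and> \<tau> e = a"
      by (metis card.empty nat.distinct(1))
    let ?A = "A - {a0}" and ?D = "{d \<in> D. \<beta> d \<noteq> \<beta> d0}"
    \<comment> \<open>The dart \<open>d0\<close> is already one of the at most two darts with its
      value, so the removal of that value costs the other elements at most one dart. Its owner, if
      any, becomes the exceptional element of the next round.\<close>
    have one: "d = e" if "d \<in> D" "e \<in> D" "\<beta> d = \<beta> d0" "\<beta> e = \<beta> d0" "\<tau> d \<noteq> a0" "\<tau> e \<noteq> a0" for d e
      using Suc.prems(3) that a0 by metis
    have "?A = {} \<or> (\<exists>a1\<in>?A. (\<exists>d\<in>?D. \<tau> d = a1) \<and>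
          (\<forall>a\<in>?A - {a1}. \<exists>d\<in>?D. \<exists>e\<in>?D. d \<noteq> e \<and> \<tau> d = a \<and> \<tau> e = a))"
    proof (cases "\<exists>d\<in>D. \<beta> d = \<beta> d0 \<and> \<tau> d \<in> ?A")
      case True
      then obtain d1 where d1: "d1 \<in> D" "\<beta> d1 = \<beta> d0" "\<tau> d1 \<in> ?A" by blast
      obtain d e where de: "d \<in> D" "e \<in> D" "d \<noteq> e" "\<tau> d = \<tau> d1" "\<tau> e = \<tau> d1"
        using oth[OF d1(3)] by blast
      have "\<tau> d1 \<noteq> a0" using d1(3) by simp
      then have "\<beta> d \<noteq> \<beta> d0 \<or> \<beta> e \<noteq> \<beta> d0" using one[OF de(1,2)] de by auto
      then have "\<exists>d\<in>?D. \<tau> d = \<tau> d1" using de by blast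
      moreover have "\<exists>d\<in>?D. \<exists>e\<in>?D. d \<noteq> e \<and> \<tau> d = a \<and> \<tau> e = a" if a: "a \<in> ?A - {\<tau> d1}" for a
      proof -
        obtain d e where de: "d \<in> D" "e \<in> D" "d \<noteq> e" "\<tau> d = a" "\<tau> e = a"
          using oth[of a] a by blast
        have "\<tau> d1 \<noteq> a0" "a \<noteq> a0" "a \<noteq> \<tau> d1" using a d1(3) by auto
        then have "\<beta> d \<noteq> \<beta> d0" "\<beta> e \<noteq> \<beta> d0"
          using one[OF de(1) d1(1)] one[OF de(2) d1(1)] d1(2) de(4,5) by auto
        with de show ?thesis by blast
      qed
      ultimately show ?thesis using d1(3) by blast
    next
      case False
      have "\<exists>d\<in>?D. \<exists>e\<in>?D. d \<noteq> e \<and> \<tau> d = a \<and> \<tau> e = a" if a: "a \<in> ?A" for a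
      proof -
        obtain d e where "d \<in> D" "e \<in> D" "d \<noteq> e" "\<tau> d = a" "\<tau> e = a"
          using oth[OF a] by blast
        moreover from this a False have "\<beta> d \<noteq> \<beta> d0" "\<beta> e \<noteq> \<beta> d0" by auto
        ultimately show ?thesis by blast
      qed
      then show ?thesis by blast
    qed
    moreover have "n = card ?A" using Suc.hyps(2) a0(1) by simp
    moreover have "finite ?A" using Suc.prems(1) by simp
    moreover have "\<forall>d\<in>?D. \<forall>e\<in>?D. \<forall>f\<in>?D. \<beta> d = \<beta> e \<longrightarrow> \<beta> e = \<beta> f \<longrightarrow> d = e \<or> e = f \<or> d = f"
      using Suc.prems(3) by blast
    ultimately obtain c where c: "\<forall>a\<in>?A. c a \<in> ?D \<and> \<tau> (c a) = a" "inj_on (\<beta> \<circ> c) ?A"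
      using Suc.hyps(1)[of ?A ?D] by blast
    let ?c = "c(a0 := d0)"
    have "\<forall>a\<in>A. ?c a \<in> D \<and> \<tau> (?c a) = a" using c(1) a0 by auto
    moreover have "inj_on (\<beta> \<circ> ?c) A"
    proof (rule inj_onI)
      fix a b assume "a \<in> A" "b \<in> A" "(\<beta> \<circ> ?c) a = (\<beta> \<circ> ?c) b"
      then show "a = b"
        using c(1) inj_onD[OF c(2), of a b] by (cases "a = a0"; cases "b = a0") auto
    qed
    ultimately show ?case by blast
  qed
  have "A = {} \<or> (\<exists>a0\<in>A. (\<exists>d\<in>D. \<tau> d = a0) \<and>
          (\<forall>a\<in>A - {a0}. \<exists>d\<in>D. \<exists>e\<in>D. d \<noteq> e \<and> \<tau> d = a \<and> \<tau> e = a))"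
    using two by (meson DiffD1 equals0I)
  moreover have "\<forall>d\<in>D. \<forall>e\<in>D. \<forall>f\<in>D. \<beta> d = \<beta> e \<longrightarrow> \<beta> e = \<beta> f \<longrightarrow> d = e \<or> e = f \<or> d = f"
    using le2 by blast
  ultimately show ?thesis using gen \<open>finite A\<close> by blast
qed

section \<open>Bounded distance in an arc set\<close>

text \<open>Distance at most \<open>n\<close>, in terms of walks in a bare arc set;
  \<open>graph_dist_greater\<close> turns its negation into a lower bound for
  \<open>graph_dist\<close>.\<close>

definition near :: "('a \<times> 'a) set \<Rightarrow> nat \<Rightarrow> 'a \<Rightarrow> 'a \<Rightarrow> bool" where
  "near E n u v \<longleftrightarrow> (\<exists>m\<le>n. (u, v) \<in> E ^^ m)"

lemma near_0 [simp]: "near E 0 u v \<longleftrightarrow> u = v"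
  by (auto simp: near_def)

lemma near_Suc: "near E (Suc n) u v \<longleftrightarrow> u = v \<or> (\<exists>w. (u, w) \<in> E \<and> near E n w v)"
proof
  assume "near E (Suc n) u v"
  then obtain m where m: "m \<le> Suc n" "(u, v) \<in> E ^^ m" by (auto simp: near_def)
  show "u = v \<or> (\<exists>w. (u, w) \<in> E \<and> near E n w v)"
  proof (cases m)
    case 0
    with m show ?thesis by simp
  next
    case (Suc k)
    with m show ?thesis unfolding near_def by (metis Suc_le_mono relpow_Suc_D2)
  qed
next
  assume "u = v \<or> (\<exists>w. (u, w) \<in> E \<and> near E n w v)"
  then show "near E (Suc n) u v"
    unfolding near_def by (metis Suc_le_mono relpow_0_I relpow_Suc_I2 zero_le)
qed

lemma near_snoc: "near E n u v \<Longrightarrow> (v, w) \<in> E \<Longrightarrow> near E (Suc n) u w"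
  unfolding near_def using relpow_Suc_I Suc_le_mono by metis

lemma near_sym:
  assumes "near E n u v" "\<And>u v. (u, v) \<in> E \<Longrightarrow> (v, u) \<in> E"
  shows "near E n v u"
  using assms(1)
proof (induction n arbitrary: u)
  case (Suc n)
  then show ?case using near_Suc near_snoc assms(2) by metis
qed simp

text \<open>The walk is cut at its first step out of \<open>Z\<close>; that step accounts for at
  least one unit of length.\<close>

lemma near_exit:
  assumes "near E (Suc n) u v" "u \<in> Z" "v \<notin> Z"
  shows "\<exists>x\<in>Z. \<exists>y. y \<notin> Z \<and> (x, y) \<in> E \<and> near E n y v"
  using assms
proof (induction n arbitrary: u)
  case 0
  then show ?case by (auto simp: near_Suc)
next
  case (Suc n)
  then obtain w where w: "(u, w) \<in> E" "near E (Suc n) w v" using near_Suc by metis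
  show ?case
  proof (cases "w \<in> Z")
    case True
    then obtain x y where "x \<in> Z" "y \<notin> Z" "(x, y) \<in> E" "near E n y v"
      using Suc.IH w(2) Suc.prems(3) by blast
    moreover from this have "near E (Suc n) y v" unfolding near_def by (meson le_SucI)
    ultimately show ?thesis by blast
  next
    case False
    with w Suc.prems show ?thesis by blast
  qed
qed

section \<open>Odd cycles in graphs of maximum degree 2\<close>

definition two_colorable :: "('a \<times> 'a) set \<Rightarrow> 'a set \<Rightarrow> bool" where
  "two_colorable E W \<longleftrightarrow> (\<exists>c :: 'a \<Rightarrow> bool. \<forall>x\<in>W. \<forall>y\<in>W. (x, y) \<in> E \<longrightarrow> c x \<noteq> c y)"

text \<open>In a graph of maximum degree 2 the minimal sets that are not 2-colourable are exactly the
  odd cycles; working with minimality avoids walks altogether.\<close>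

definition odd_rings :: "('a \<times> 'a) set \<Rightarrow> 'a set \<Rightarrow> 'a set set" where
  "odd_rings E Q = {Z. Z \<subseteq> Q \<and> \<not> two_colorable E Z \<and> (\<forall>Y. Y \<subset> Z \<longrightarrow> two_colorable E Y)}"

text \<open>Apart from disjointness, the distance estimates use only these properties of an odd
  cycle, not its parity or connectedness.\<close>

definition ring_in :: "('a \<times> 'a) set \<Rightarrow> 'a set \<Rightarrow> 'a set \<Rightarrow> bool" where
  "ring_in E Q Z \<longleftrightarrow> Z \<subseteq> Q \<and> (\<forall>z\<in>Z. \<exists>a\<in>Z. \<exists>b\<in>Z. a \<noteq> b \<and> (z, a) \<in> E \<and> (z, b) \<in> E) \<and>
     (\<forall>z\<in>Z. \<forall>q\<in>Q. (z, q) \<in> E \<longrightarrow> q \<in> Z)"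

lemma ring_in_subset: "ring_in E Q Z \<Longrightarrow> Z \<subseteq> Q"
  by (simp add: ring_in_def)

lemma ring_in_closed: "ring_in E Q Z \<Longrightarrow> z \<in> Z \<Longrightarrow> q \<in> Q \<Longrightarrow> (z, q) \<in> E \<Longrightarrow> q \<in> Z"
  by (simp add: ring_in_def)

lemma ring_in_two:
  assumes "ring_in E Q Z" "z \<in> Z"
  obtains a b where "a \<in> Z" "b \<in> Z" "a \<noteq> b" "(z, a) \<in> E" "(z, b) \<in> E"
  using assms unfolding ring_in_def by blast

lemma two_colorable_union:
  assumes "two_colorable E A" "two_colorable E B"
    and "\<And>x y. x \<in> A \<Longrightarrow> y \<in> B \<Longrightarrow> (x, y) \<notin> E \<and> (y, x) \<notin> E"
  shows "two_colorable E (A \<union> B)"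
proof -
  obtain c d :: "'a \<Rightarrow> bool" where
    "\<forall>x\<in>A. \<forall>y\<in>A. (x, y) \<in> E \<longrightarrow> c x \<noteq> c y" "\<forall>x\<in>B. \<forall>y\<in>B. (x, y) \<in> E \<longrightarrow> d x \<noteq> d y"
    using assms(1,2) unfolding two_colorable_def by blast
  with assms(3) have "\<forall>x\<in>A \<union> B. \<forall>y\<in>A \<union> B. (x, y) \<in> E \<longrightarrow>
      (if x \<in> A then c x else d x) \<noteq> (if y \<in> A then c y else d y)"
    by (metis Un_iff)
  then show ?thesis unfolding two_colorable_def
    by (intro exI[of _ "\<lambda>x. if x \<in> A then c x else d x"])
qed

locale max_degree_two =
  fixes E :: "('a \<times> 'a) set" and Q :: "'a set"
  assumes E_sym: "\<And>u v. (u, v) \<in> E \<Longrightarrow> (v, u) \<in> E"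
    and E_irrefl: "\<And>v. (v, v) \<notin> E"
    and Q_finite: "finite Q"
    and Q_deg: "\<And>v a b c. \<lbrakk>v \<in> Q; a \<in> Q; b \<in> Q; c \<in> Q; (v, a) \<in> E; (v, b) \<in> E; (v, c) \<in> E\<rbrakk>
                  \<Longrightarrow> a = b \<or> b = c \<or> a = c"
begin

text \<open>By minimality \<open>Z - {z}\<close> has a 2-colouring, and it would extend to a vertex
  \<open>z\<close> with at most one neighbour in \<open>Z\<close>. So \<open>z\<close> has two
  neighbours in \<open>Z\<close>, and the degree bound leaves none for the rest of
  \<open>Q\<close>.\<close>

lemma odd_ring_ring_in:
  assumes "Z \<in> odd_rings E Q"
  shows "ring_in E Q Z"
proof -
  have Z: "Z \<subseteq> Q" "\<not> two_colorable E Z" "\<And>Y. Y \<subset> Z \<Longrightarrow> two_colorable E Y"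
    using assms unfolding odd_rings_def by auto
  have two: "\<exists>a\<in>Z. \<exists>b\<in>Z. a \<noteq> b \<and> (z, a) \<in> E \<and> (z, b) \<in> E" if "z \<in> Z" for z
  proof (rule ccontr)
    assume neg: "\<not> ?thesis"
    have "two_colorable E (Z - {z})" using that by (intro Z(3)) auto
    then obtain c :: "'a \<Rightarrow> bool"
      where c: "\<And>x y. \<lbrakk>x \<in> Z; x \<noteq> z; y \<in> Z; y \<noteq> z; (x, y) \<in> E\<rbrakk> \<Longrightarrow> c x \<noteq> c y"
      unfolding two_colorable_def by auto
    obtain b where b: "\<And>a. a \<in> Z \<Longrightarrow> (z, a) \<in> E \<Longrightarrow> c a \<noteq> b"
    proof (cases "\<exists>a\<in>Z. (z, a) \<in> E")
      case True
      then obtain a where "a \<in> Z" "(z, a) \<in> E" by blast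
      with neg have "c a' \<noteq> (\<not> c a)" if "a' \<in> Z" "(z, a') \<in> E" for a' using that by auto
      then show ?thesis by (rule that)
    qed (use that in blast)
    have "(c(z := b)) x \<noteq> (c(z := b)) y" if xy: "x \<in> Z" "y \<in> Z" "(x, y) \<in> E" for x y
      using b[OF xy(1)] b[OF xy(2)] c[OF xy(1) _ xy(2) _ xy(3)] E_sym[OF xy(3)] E_irrefl xy(3)
      by (cases "x = z"; cases "y = z") auto
    then have "two_colorable E Z" unfolding two_colorable_def by (intro exI[of _ "c(z := b)"]) simp
    with Z(2) show False ..
  qed
  moreover have "q \<in> Z" if "z \<in> Z" "q \<in> Q" "(z, q) \<in> E" for z q
    using two[OF that(1)] Z(1) Q_deg that by (metis subsetD)
  ultimately show ?thesis using Z(1) unfolding ring_in_def by blast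
qed

text \<open>No edge joins \<open>Z - Z'\<close> to \<open>Z \<inter> Z'\<close>, because
  \<open>Z'\<close> is closed in \<open>Q\<close>. If both were proper subsets of \<open>Z\<close>,
  their 2-colourings would combine to one of \<open>Z\<close>.\<close>

lemma odd_ring_subset:
  assumes "Z \<in> odd_rings E Q" "Z' \<in> odd_rings E Q" "Z \<inter> Z' \<noteq> {}"
  shows "Z \<subseteq> Z'"
proof (rule ccontr)
  assume "\<not> Z \<subseteq> Z'"
  then have "Z - Z' \<subset> Z" "Z \<inter> Z' \<subset> Z" using assms(3) by blast+
  then have "two_colorable E (Z - Z')" "two_colorable E (Z \<inter> Z')"
    using assms(1) unfolding odd_rings_def by auto
  moreover have "(x, y) \<notin> E \<and> (y, x) \<notin> E" if "x \<in> Z - Z'" "y \<in> Z \<inter> Z'" for x y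
    using that ring_in_closed[OF odd_ring_ring_in[OF assms(2)], of y x]
      ring_in_subset[OF odd_ring_ring_in[OF assms(1)]] E_sym by blast
  ultimately have "two_colorable E ((Z - Z') \<union> (Z \<inter> Z'))" by (rule two_colorable_union)
  then show False using assms(1) by (simp add: odd_rings_def Un_Diff_Int)
qed

lemma odd_rings_disjoint:
  assumes "Z \<in> odd_rings E Q" "Z' \<in> odd_rings E Q" "Z \<noteq> Z'"
  shows "Z \<inter> Z' = {}"
proof (rule ccontr)
  assume "Z \<inter> Z' \<noteq> {}"
  then have "Z \<subseteq> Z'" "Z' \<subseteq> Z"
    using odd_ring_subset[OF assms(1,2)] odd_ring_subset[OF assms(2,1)] by (auto simp: Int_commute)
  with assms(3) show False by simp
qed

lemma odd_ring_exists:
  assumes "W \<subseteq> Q" "\<not> two_colorable E W"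
  shows "\<exists>Z\<in>odd_rings E Q. Z \<subseteq> W"
proof -
  have "finite {Z. Z \<subseteq> W \<and> \<not> two_colorable E Z}"
    using Q_finite assms(1) by (simp add: finite_subset)
  from finite_has_minimal2[OF this, of W] assms(2)
  obtain Z where "Z \<subseteq> W" "\<not> two_colorable E Z" "\<And>Y. Y \<subseteq> Z \<Longrightarrow> \<not> two_colorable E Y \<Longrightarrow> Z = Y"
    by (auto simp: subset_trans)
  with assms(1) show ?thesis unfolding odd_rings_def by blast
qed

text \<open>One vertex is picked from each odd ring. As the rings are disjoint, each contains only
  its own pick, and a rest that is not 2-colourable would contain a ring without a pick.\<close>

lemma odd_ring_transversal:
  obtains R where "R \<subseteq> Q" "two_colorable E (Q - R)"
    "\<And>r. r \<in> R \<Longrightarrow> \<exists>Z\<in>odd_rings E Q. r \<in> Z"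
    "\<And>r r' Z. \<lbrakk>r \<in> R; r' \<in> R; Z \<in> odd_rings E Q; r \<in> Z; r' \<in> Z\<rbrakk> \<Longrightarrow> r = r'"
proof -
  define pick where "pick Z = (SOME z. z \<in> Z)" for Z :: "'a set"
  have pick: "pick Z \<in> Z" if "Z \<in> odd_rings E Q" for Z
  proof -
    have "Z \<noteq> {}" using that by (auto simp: odd_rings_def two_colorable_def)
    then show ?thesis unfolding pick_def by (simp add: some_in_eq)
  qed
  let ?R = "pick ` odd_rings E Q"
  have sub: "?R \<subseteq> Q" using pick by (auto simp: odd_rings_def)
  have col: "two_colorable E (Q - ?R)"
  proof (rule ccontr)
    assume "\<not> ?thesis"
    then obtain Z where "Z \<in> odd_rings E Q" "Z \<subseteq> Q - ?R" using odd_ring_exists by blast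
    then show False using pick by blast
  qed
  have uniq: "r = r'" if "r \<in> ?R" "r' \<in> ?R" "Z \<in> odd_rings E Q" "r \<in> Z" "r' \<in> Z" for r r' Z
  proof -
    have *: "r = pick Z" if "r \<in> ?R" "r \<in> Z" for r
      using that pick odd_rings_disjoint \<open>Z \<in> odd_rings E Q\<close> by blast
    from *[OF that(1,4)] *[OF that(2,5)] show ?thesis by simp
  qed
  have mem: "\<exists>Z\<in>odd_rings E Q. r \<in> Z" if "r \<in> ?R" for r
    using that pick by blast
  show thesis
    using that[OF sub col mem uniq] .
qed

end

section \<open>Inner vertices of a subcubic graph\<close>

locale subcubic_graph =
  fixes V :: "'a set" and E :: "('a \<times> 'a) set"
  assumes finite_V: "finite V"
    and E_subset: "E \<subseteq> V \<times> V"
    and adj_sym: "(u, v) \<in> E \<Longrightarrow> (v, u) \<in> E"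
    and adj_irrefl: "(v, v) \<notin> E"
    and deg_le_3: "card (E `` {v}) \<le> 3"
begin

definition deg :: "'a \<Rightarrow> nat" where
  "deg v = card (E `` {v})"

definition cnb :: "'a \<Rightarrow> 'a set" where
  "cnb v = insert v (E `` {v})"

text \<open>The first conjunct excludes points without neighbours, in particular every point outside
  \<open>V\<close>, for which the second is vacuous.\<close>

definition inner :: "'a \<Rightarrow> bool" where
  "inner p \<longleftrightarrow> E `` {p} \<noteq> {} \<and> (\<forall>q. (p, q) \<in> E \<longrightarrow> (\<exists>c. (p, c) \<in> E \<and> (q, c) \<in> E))"

definition open_tri :: "'a set \<Rightarrow> bool" where
  "open_tri t \<longleftrightarrow> (\<exists>x y z. t = {x, y, z} \<and> (x, y) \<in> E \<and> (y, z) \<in> E \<and> (x, z) \<in> E) \<and>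
     (\<forall>x\<in>t. \<not> inner x)"

text \<open>Only meaningful for a vertex of an open triangle, where it is the neighbour outside the
  triangle.\<close>

definition out :: "'a \<Rightarrow> 'a" where
  "out x = (SOME q. (x, q) \<in> E \<and> (\<forall>c. (x, c) \<in> E \<longrightarrow> (q, c) \<notin> E))"

lemma finite_nb [simp]: "finite (E `` {v})"
  by (rule finite_subset[OF _ finite_V]) (use E_subset in auto)

lemma nb_four:
  assumes "(v, a) \<in> E" "(v, b) \<in> E" "(v, c) \<in> E" "(v, d) \<in> E"
  shows "a = b \<or> a = c \<or> a = d \<or> b = c \<or> b = d \<or> c = d"
proof (rule ccontr)
  assume "\<not> ?thesis"
  then have "card {a, b, c, d} = 4" by auto
  moreover have "card {a, b, c, d} \<le> card (E `` {v})"
    using assms by (intro card_mono) auto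
  ultimately show False using deg_le_3[of v] by simp
qed

lemma nb_three:
  assumes "deg v \<le> 2" "(v, a) \<in> E" "(v, b) \<in> E" "(v, c) \<in> E"
  shows "a = b \<or> a = c \<or> b = c"
proof (rule ccontr)
  assume "\<not> ?thesis"
  then have "card {a, b, c} = 3" by auto
  moreover have "card {a, b, c} \<le> card (E `` {v})"
    using assms by (intro card_mono) auto
  ultimately show False using assms(1) unfolding deg_def by simp
qed

lemma deg_eq_3I:
  assumes "(v, a) \<in> E" "(v, b) \<in> E" "(v, c) \<in> E" "a \<noteq> b" "a \<noteq> c" "b \<noteq> c"
  shows "deg v = 3" "E `` {v} = {a, b, c}"
proof -
  have c: "card {a, b, c} = 3" using assms by simp
  have "{a, b, c} \<subseteq> E `` {v}" using assms by auto
  then show "E `` {v} = {a, b, c}"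
    using c deg_le_3[of v] card_seteq[of "E `` {v}" "{a, b, c}"] by simp
  with c show "deg v = 3" by (simp add: deg_def)
qed

lemma mem_cnb: "x \<in> cnb v \<longleftrightarrow> x = v \<or> (v, x) \<in> E"
  by (auto simp: cnb_def)

lemma inner_common:
  assumes "inner p" "(p, q) \<in> E"
  obtains c where "(p, c) \<in> E" "(q, c) \<in> E" "c \<noteq> p" "c \<noteq> q"
proof -
  obtain c where "(p, c) \<in> E" "(q, c) \<in> E" using assms unfolding inner_def by auto
  then show thesis using that[of c] adj_irrefl by auto
qed

text \<open>Let \<open>c\<close> be a common neighbour. If \<open>p\<close> and \<open>q\<close> had
  private neighbours \<open>e\<close> and \<open>g\<close>, the triangles on the edges
  \<open>pe\<close> and \<open>qg\<close> would have to use \<open>c\<close>, which would give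
  \<open>c\<close> the four neighbours \<open>p\<close>, \<open>q\<close>, \<open>e\<close>,
  \<open>g\<close>.\<close>

lemma inner_cnb_adj:
  assumes "inner p" "inner q" "(p, q) \<in> E"
  shows "cnb p \<subseteq> cnb q \<or> cnb q \<subseteq> cnb p"
proof (rule ccontr)
  assume neg: "\<not> ?thesis"
  obtain c where c: "(p, c) \<in> E" "(q, c) \<in> E" "c \<noteq> p" "c \<noteq> q"
    using inner_common[OF assms(1,3)] .
  have qp: "(q, p) \<in> E" using assms(3) by (rule adj_sym)
  obtain e where e: "(p, e) \<in> E" "e \<noteq> q" "(q, e) \<notin> E"
    using neg qp by (auto simp: mem_cnb subset_iff)
  obtain g where g: "(q, g) \<in> E" "g \<noteq> p" "(p, g) \<notin> E"
    using neg assms(3) by (auto simp: mem_cnb subset_iff)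
  have Np: "E `` {p} = {q, c, e}" using deg_eq_3I(2) assms(3) c e by metis
  have Nq: "E `` {q} = {p, c, g}" using deg_eq_3I(2) qp c g by metis
  \<comment> \<open>The third vertex of a triangle on the edge \<open>pe\<close> is \<open>q\<close>
    or \<open>c\<close>, and \<open>q\<close> is not adjacent to \<open>e\<close>.\<close>
  obtain a where a: "(p, a) \<in> E" "(e, a) \<in> E" "a \<noteq> e" using inner_common[OF assms(1) e(1)] .
  then have "a = q \<or> a = c" using Np by blast
  then have ce: "(c, e) \<in> E" using a(2) e(3) adj_sym by metis
  obtain b where b: "(q, b) \<in> E" "(g, b) \<in> E" "b \<noteq> g" using inner_common[OF assms(2) g(1)] .
  then have "b = p \<or> b = c" using Nq by blast
  then have cg: "(c, g) \<in> E" using b(2) g(3) adj_sym by metis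
  have "(c, p) \<in> E" "(c, q) \<in> E" using c adj_sym by auto
  with nb_four[OF this ce cg] show False using e g adj_irrefl assms(3) by metis
qed

text \<open>If \<open>p\<close> and \<open>q\<close> are distinct and not adjacent, the degree of
  \<open>x\<close> forces a single vertex \<open>c\<close> to complete the triangles on both
  \<open>px\<close> and \<open>qx\<close>. The four vertices form a complete graph without the edge
  \<open>pq\<close>, so \<open>x\<close> is inner, and its closed neighbourhood contains both
  others.\<close>

lemma inner_cnb_meet:
  assumes "inner p" "inner q" "x \<in> cnb p" "x \<in> cnb q"
  shows "\<exists>r. inner r \<and> cnb p \<subseteq> cnb r \<and> cnb q \<subseteq> cnb r"
proof (cases "p = q \<or> (p, q) \<in> E")
  case True
  then have "cnb p \<subseteq> cnb q \<or> cnb q \<subseteq> cnb p" using inner_cnb_adj[OF assms(1,2)] by auto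
  then show ?thesis using assms(1,2) order_refl by metis
next
  case False
  then have px: "(p, x) \<in> E" and qx: "(q, x) \<in> E"
    using assms(3,4) by (auto simp: mem_cnb dest: adj_sym)
  have False': "p \<noteq> q" "(p, q) \<notin> E" "(q, p) \<notin> E" using False by (auto dest: adj_sym)
  obtain c where c: "(p, c) \<in> E" "(x, c) \<in> E" "c \<noteq> p" "c \<noteq> x"
    using inner_common[OF assms(1) px] .
  obtain g where g: "(q, g) \<in> E" "(x, g) \<in> E" "g \<noteq> q" "g \<noteq> x"
    using inner_common[OF assms(2) qx] .
  have xp: "(x, p) \<in> E" and xq: "(x, q) \<in> E" using px qx adj_sym by auto
  have gc: "g = c" using nb_four[OF xp xq c(2) g(2)] False' c g by metis
  have Nx: "E `` {x} = {p, q, c}" using deg_eq_3I(2)[OF xp xq c(2)] False' c g gc by metis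
  have Nc: "E `` {c} = {p, q, x}"
    using deg_eq_3I(2)[of c p q x] adj_sym c g gc False' px qx adj_irrefl by metis
  have inn: "inner x"
  proof -
    have adj: "(x, c) \<in> E" "(p, c) \<in> E" "(q, c) \<in> E" "(x, p) \<in> E" "(c, p) \<in> E"
      using c g gc adj_sym xp by auto
    have "\<exists>b. (x, b) \<in> E \<and> (a, b) \<in> E" if "(x, a) \<in> E" for a
    proof -
      from that Nx have "a = p \<or> a = q \<or> a = c" by blast
      with adj show ?thesis by metis
    qed
    with adj(1) show ?thesis unfolding inner_def by auto
  qed
  \<comment> \<open>Applied to \<open>s = p\<close> and \<open>s = q\<close>. A further neighbour
    \<open>e\<close> of \<open>s\<close> would need \<open>x\<close> or \<open>c\<close> as a common
    neighbour with \<open>s\<close>, but both have their three neighbours already.\<close>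
  have sub: "cnb s \<subseteq> cnb x" if s: "inner s" "(s, x) \<in> E" "(s, c) \<in> E"
     "\<And>a. (s, a) \<in> E \<Longrightarrow> a \<noteq> p \<and> a \<noteq> q" for s
  proof (rule ccontr)
    assume "\<not> ?thesis"
    moreover have "s \<in> cnb x" using adj_sym[OF s(2)] by (simp add: mem_cnb)
    ultimately obtain e where e: "(s, e) \<in> E" "e \<noteq> x" "(x, e) \<notin> E"
      by (auto simp: mem_cnb subset_iff)
    obtain a where a: "(s, a) \<in> E" "(e, a) \<in> E" "a \<noteq> e" using inner_common[OF s(1) e(1)] .
    have "e \<noteq> c" using e c by blast
    then have "E `` {s} = {x, c, e}" using deg_eq_3I(2) s e c(4) by metis
    then have "a = x \<or> a = c" using a by blast
    then have "e \<in> E `` {x} \<or> e \<in> E `` {c}" using adj_sym[OF a(2)] by blast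
    then have "e = p \<or> e = q" using Nc e by blast
    with s(4) e(1) show False by blast
  qed
  have "cnb p \<subseteq> cnb x" using sub[OF assms(1) px c(1)] False'(2) adj_irrefl by metis
  moreover have "cnb q \<subseteq> cnb x" using sub[OF assms(2) qx] g(1) gc False'(3) adj_irrefl by metis
  ultimately show ?thesis using inn by metis
qed

text \<open>By \<open>inner_cnb_meet\<close> distinct maximal closed neighbourhoods of inner
  vertices are disjoint. Several inner vertices may share one such neighbourhood, so the
  representatives are chosen per neighbourhood.\<close>

lemma inner_packing_exists:
  obtains P where "\<And>p. p \<in> P \<Longrightarrow> inner p"
    "\<And>p. inner p \<Longrightarrow> \<exists>q\<in>P. cnb p \<subseteq> cnb q"
    "\<And>p q x. \<lbrakk>p \<in> P; q \<in> P; x \<in> cnb p; x \<in> cnb q\<rbrakk> \<Longrightarrow> p = q"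
proof -
  define C where "C = cnb ` {p. inner p}"
  define M where "M = {c \<in> C. \<forall>b\<in>C. c \<subseteq> b \<longrightarrow> c = b}"
  define rep where "rep c = (SOME p. inner p \<and> cnb p = c)" for c
  have rep: "inner (rep c)" "cnb (rep c) = c" if "c \<in> M" for c
  proof -
    have "\<exists>p. inner p \<and> cnb p = c" using that unfolding M_def C_def by blast
    from someI_ex[OF this] show "inner (rep c)" "cnb (rep c) = c" by (auto simp: rep_def)
  qed
  have "C \<subseteq> Pow V"
    using E_subset by (auto simp: C_def cnb_def inner_def)
  then have fin: "finite C"
    using finite_V finite_subset by blast
  show thesis
  proof (rule that[of "rep ` M"])
    show "inner p" if "p \<in> rep ` M" for p using that rep(1) by blast
  next
    fix p assume "inner p"
    then have "cnb p \<in> C" by (simp add: C_def)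
    from finite_has_maximal2[OF fin this] obtain c where c: "c \<in> M" "cnb p \<subseteq> c"
      unfolding M_def by blast
    then show "\<exists>q\<in>rep ` M. cnb p \<subseteq> cnb q" using rep(2)[OF c(1)] by auto
  next
    fix p q x assume pq: "p \<in> rep ` M" "q \<in> rep ` M" "x \<in> cnb p" "x \<in> cnb q"
    then obtain b c where bc: "b \<in> M" "c \<in> M" "p = rep b" "q = rep c" by blast
    have "inner p" "inner q" using bc rep by auto
    from inner_cnb_meet[OF this pq(3,4)] obtain r
      where r: "inner r" "cnb p \<subseteq> cnb r" "cnb q \<subseteq> cnb r" by blast
    have "b \<subseteq> cnb r" "c \<subseteq> cnb r" using bc rep r by auto
    moreover have "cnb r \<in> C" using r(1) by (simp add: C_def)
    ultimately have "b = cnb r" "c = cnb r" using bc(1,2) unfolding M_def by auto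
    with bc show "p = q" by simp
  qed
qed

section \<open>Open triangles and their outer neighbours\<close>

lemma deg_le: "deg v \<le> 3"
  using deg_le_3 by (simp add: deg_def)

lemma out_adj:
  assumes "open_tri t" "x \<in> t"
  shows "(x, out x) \<in> E" "(x, c) \<in> E \<Longrightarrow> (out x, c) \<notin> E"
proof -
  have "E `` {x} \<noteq> {}" using assms adj_sym unfolding open_tri_def by fastforce
  then have "\<exists>q. (x, q) \<in> E \<and> (\<forall>c. (x, c) \<in> E \<longrightarrow> (q, c) \<notin> E)"
    using assms unfolding open_tri_def inner_def by auto
  from someI_ex[OF this] show "(x, out x) \<in> E" "(x, c) \<in> E \<Longrightarrow> (out x, c) \<notin> E"
    by (auto simp: out_def)
qed

lemma open_triE:
  assumes "open_tri t" "x \<in> t"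
  obtains y z where "t = {x, y, z}" "(x, y) \<in> E" "(y, z) \<in> E" "(x, z) \<in> E"
    "x \<noteq> y" "y \<noteq> z" "x \<noteq> z"
proof -
  obtain a b c where t: "t = {a, b, c}" "(a, b) \<in> E" "(b, c) \<in> E" "(a, c) \<in> E"
    using assms unfolding open_tri_def by blast
  have s: "(b, a) \<in> E" "(c, b) \<in> E" "(c, a) \<in> E" "a \<noteq> b" "b \<noteq> c" "a \<noteq> c"
    using t adj_sym adj_irrefl by metis+
  from assms(2) t(1) consider "x = a" | "x = b" | "x = c" by blast
  then show thesis
  proof cases
    case 1 then show thesis using that[of b c] t s by blast
  next
    case 2 then show thesis using that[of a c] t s by blast
  next
    case 3 then show thesis using that[of a b] t s by blast
  qed
qed

lemma open_tri_nb:
  assumes "open_tri t" "x \<in> t"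
  shows "deg x = 3" "E `` {x} = insert (out x) (t - {x})" "out x \<notin> t"
proof -
  obtain y z where t: "t = {x, y, z}" "(x, y) \<in> E" "(y, z) \<in> E" "(x, z) \<in> E"
    "x \<noteq> y" "y \<noteq> z" "x \<noteq> z" using open_triE[OF assms] .
  note o = out_adj[OF assms]
  have ne: "out x \<noteq> y" "out x \<noteq> z" "out x \<noteq> x" using t o adj_sym adj_irrefl by metis+
  note d = deg_eq_3I[OF t(2,4) o(1) t(6) ne(1,2)[symmetric]]
  from d show "deg x = 3" "E `` {x} = insert (out x) (t - {x})" using t by auto
  show "out x \<notin> t" using ne t by blast
qed

text \<open>The only neighbour of \<open>x\<close> outside \<open>t\<close> is \<open>out x\<close>,
  and the edge to it lies in no triangle.\<close>

lemma open_tri_common_nb: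
  assumes "open_tri t" "x \<in> t" "(x, a) \<in> E" "(x, b) \<in> E" "(a, b) \<in> E"
  shows "a \<in> t"
proof -
  have "a \<in> insert (out x) (t - {x})" using open_tri_nb(2)[OF assms(1,2)] assms(3) by auto
  with out_adj(2)[OF assms(1,2,4)] assms(5) show ?thesis by auto
qed

lemma open_tri_unique:
  assumes "open_tri t" "x \<in> t" "open_tri t'" "x \<in> t'"
  shows "t = t'"
proof -
  have "s \<subseteq> r" if s: "open_tri s" "x \<in> s" and r: "open_tri r" "x \<in> r" for s r
  proof -
    obtain y z where "s = {x, y, z}" "(x, y) \<in> E" "(y, z) \<in> E" "(x, z) \<in> E"
      using open_triE[OF s] .
    then show ?thesis using open_tri_common_nb[OF r, of y z] open_tri_common_nb[OF r, of z y]
      adj_sym r by auto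
  qed
  with assms show ?thesis by blast
qed

text \<open>If \<open>p\<close> were an inner neighbour of \<open>x\<close>, the edge
  \<open>px\<close> would lie in a triangle. At \<open>x\<close> the only triangle is
  \<open>t\<close>, which has no inner vertex.\<close>

lemma open_tri_not_inner_cnb:
  assumes "open_tri t" "x \<in> t" "inner p"
  shows "x \<notin> cnb p"
proof
  assume x: "x \<in> cnb p"
  have ni: "p \<notin> t" using assms unfolding open_tri_def by blast
  then have px: "(p, x) \<in> E" using x assms(2) by (auto simp: mem_cnb)
  then obtain c where "(p, c) \<in> E" "(x, c) \<in> E" using inner_common[OF assms(3)] by blast
  then show False using open_tri_common_nb[OF assms(1,2) adj_sym[OF px]] ni by blast
qed

text \<open>An inner neighbour \<open>p\<close> of \<open>out x\<close> forms a triangle with it.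
  This triangle uses both edges of \<open>out x\<close>, hence contains \<open>x\<close>, and so
  \<open>x\<close> would lie in the closed neighbourhood of \<open>p\<close>.\<close>

lemma out_not_inner_cnb:
  assumes "open_tri t" "x \<in> t" "deg (out x) \<le> 2" "inner p"
  shows "out x \<notin> cnb p"
proof
  assume q: "out x \<in> cnb p"
  note o = out_adj[OF assms(1,2)]
  show False
  proof (cases "p = out x")
    case True
    then have "(p, x) \<in> E" using o adj_sym by blast
    with inner_common[OF assms(4)] True o(2) show False by metis
  next
    case False
    then have pq: "(p, out x) \<in> E" using q by (auto simp: mem_cnb)
    obtain c where c: "(p, c) \<in> E" "(out x, c) \<in> E" "c \<noteq> p" using inner_common[OF assms(4) pq] .
    have "p = x \<or> c = x" using nb_three[OF assms(3) adj_sym[OF pq] c(2) adj_sym[OF o(1)]] c by blast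
    then show False
      using c pq o adj_sym open_tri_not_inner_cnb[OF assms(1,2,4)] by (auto simp: mem_cnb)
  qed
qed

section \<open>Low and high vertices of open triangles\<close>

definition low :: "'a \<Rightarrow> bool" where
  "low x \<longleftrightarrow> (\<exists>t. open_tri t \<and> x \<in> t) \<and> deg (out x) \<le> 2"

text \<open>Recovers the open triangle from its vertex, as a total function that can serve as \<tau>
  in \<open>injective_dart_choice\<close>.\<close>

definition tri_of :: "'a \<Rightarrow> 'a set" where
  "tri_of x = cnb x - {out x}"

lemma tri_of_eq: "open_tri t \<Longrightarrow> x \<in> t \<Longrightarrow> tri_of x = t"
  using open_tri_nb[of t x] by (auto simp: tri_of_def cnb_def)

lemma cnb_open: "open_tri t \<Longrightarrow> x \<in> t \<Longrightarrow> cnb x = insert (out x) t"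
  using open_tri_nb[of t x] by (auto simp: cnb_def)

text \<open>The injective choice serves the triangles with two low vertices, with \<beta> the outer
  neighbour. The result is then enlarged to a maximal set; the last property says that a low vertex
  of an unserved triangle is blocked only by its outer neighbour.\<close>

lemma low_picks_exist:
  obtains L where "\<And>x. x \<in> L \<Longrightarrow> low x"
    "\<And>x y. \<lbrakk>x \<in> L; y \<in> L; tri_of x = tri_of y\<rbrakk> \<Longrightarrow> x = y"
    "\<And>x y. \<lbrakk>x \<in> L; y \<in> L; out x = out y\<rbrakk> \<Longrightarrow> x = y"
    "\<And>t x y. \<lbrakk>open_tri t; x \<in> t; y \<in> t; x \<noteq> y; low x; low y\<rbrakk> \<Longrightarrow> t \<inter> L \<noteq> {}"
    "\<And>t z. \<lbrakk>open_tri t; z \<in> t; low z; t \<inter> L = {}\<rbrakk> \<Longrightarrow> \<exists>x\<in>L. out x = out z"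
proof -
  define A where "A = {t. open_tri t \<and> (\<exists>x\<in>t. \<exists>y\<in>t. x \<noteq> y \<and> low x \<and> low y)}"
  have inV: "t \<subseteq> V" if "open_tri t" for t
    using that E_subset unfolding open_tri_def by auto
  have "A \<subseteq> Pow V" using inV unfolding A_def by blast
  then have "finite A" using finite_V finite_subset by blast
  moreover have "\<exists>d\<in>Collect low. \<exists>e\<in>Collect low. d \<noteq> e \<and> tri_of d = a \<and> tri_of e = a"
    if "a \<in> A" for a
    using that tri_of_eq unfolding A_def by blast
  moreover have "d = e \<or> e = f \<or> d = f"
    if "d \<in> Collect low" "e \<in> Collect low" "f \<in> Collect low" "out d = out e" "out e = out f" for d e f
  proof -
    have *: "(out g, g) \<in> E" if "low g" for g
      using that out_adj(1) adj_sym unfolding low_def by blast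
    have "(out d, d) \<in> E" "(out d, e) \<in> E" "(out d, f) \<in> E"
      using *[of d] *[of e] *[of f] that by auto
    moreover have "deg (out d) \<le> 2" using that by (simp add: low_def)
    ultimately show ?thesis using nb_three by metis
  qed
  ultimately have "\<exists>c. (\<forall>a\<in>A. c a \<in> Collect low \<and> tri_of (c a) = a) \<and> inj_on (out \<circ> c) A"
    by (rule injective_dart_choice)
  then obtain c where c: "\<And>a. a \<in> A \<Longrightarrow> low (c a) \<and> tri_of (c a) = a" "inj_on (out \<circ> c) A"
    by blast
  \<comment> \<open>Containing the image of \<open>c\<close> keeps the triangles with two low
    vertices served in every enlargement.\<close>
  define good where "good L \<longleftrightarrow> c ` A \<subseteq> L \<and> L \<subseteq> Collect low \<and> inj_on tri_of L \<and> inj_on out L"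
    for L
  have "good (c ` A)"
    unfolding good_def using c by (auto simp: inj_on_def)
  then have c_good: "c ` A \<in> {L. good L}" by simp
  have "{L. good L} \<subseteq> Pow V"
    using inV unfolding good_def low_def by blast
  then have "finite {L. good L}" using finite_V finite_subset by blast
  from finite_has_maximal2[OF this c_good]
  obtain L where L: "good L" "\<And>M. good M \<Longrightarrow> L \<subseteq> M \<Longrightarrow> L = M" by auto
  show thesis
  proof (rule that[of L])
    show "low x" if "x \<in> L" for x using that L(1) unfolding good_def by blast
    show "x = y" if "x \<in> L" "y \<in> L" "tri_of x = tri_of y" for x y
      using that L(1) unfolding good_def by (meson inj_onD)
    show "x = y" if "x \<in> L" "y \<in> L" "out x = out y" for x y
      using that L(1) unfolding good_def by (meson inj_onD)
    show "t \<inter> L \<noteq> {}" if "open_tri t" "x \<in> t" "y \<in> t" "x \<noteq> y" "low x" "low y" for t x y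
    proof -
      have "t \<in> A" using that unfolding A_def by blast
      then have "c t \<in> L" "tri_of (c t) = t" "low (c t)" using L(1) c unfolding good_def by auto
      moreover from this have "c t \<in> t" using tri_of_eq unfolding low_def by metis
      ultimately show ?thesis by blast
    qed
    show "\<exists>x\<in>L. out x = out z" if z: "open_tri t" "z \<in> t" "low z" "t \<inter> L = {}" for t z
    proof (rule ccontr)
      assume neg: "\<not> ?thesis"
      have "tri_of x \<noteq> tri_of z" if "x \<in> L" for x
      proof -
        have "low x" using that L(1) unfolding good_def by blast
        then obtain s where "open_tri s" "x \<in> s" unfolding low_def by blast
        then have "tri_of x = s" "x \<in> s" by (auto simp: tri_of_eq)
        moreover have "tri_of z = t" using z by (simp add: tri_of_eq)
        ultimately show ?thesis using z(4) that by auto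
      qed
      then have "tri_of z \<notin> tri_of ` L" by (metis imageE)
      moreover have "out z \<notin> out ` L" using neg by (metis imageE)
      ultimately have "good (insert z L)"
        using L(1) z(3) unfolding good_def by (auto simp: inj_on_insert)
      from L(2)[OF this] z(2,4) show False by blast
    qed
  qed
qed

definition hv :: "'a \<Rightarrow> bool" where
  "hv v \<longleftrightarrow> deg v = 3 \<and> (\<forall>u. (v, u) \<in> E \<longrightarrow> deg u = 3)"

text \<open>The neighbours inside the triangle have degree 3 anyway, so only the outer neighbour
  decides whether \<open>x\<close> is heavy.\<close>

lemma high_hv:
  assumes "open_tri t" "x \<in> t" "\<not> low x"
  shows "hv x" "deg (out x) = 3"
proof -
  show o: "deg (out x) = 3"
    using assms deg_le[of "out x"] unfolding low_def by fastforce
  have "deg u = 3" if "(x, u) \<in> E" for u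
  proof -
    have "u \<in> insert (out x) (t - {x})" using that open_tri_nb(2)[OF assms(1,2)] by auto
    then show ?thesis using o open_tri_nb(1)[OF assms(1)] by auto
  qed
  then show "hv x" using open_tri_nb(1)[OF assms(1,2)] by (simp add: hv_def)
qed

end

section \<open>Special triangles and their hubs\<close>

text \<open>The first assumption comes from local girth 3, the second is the saturation bound 1,
  which covers both values of \<open>i\<close>.\<close>

locale saturated_graph = subcubic_graph +
  assumes triangle: "deg v = 3 \<Longrightarrow> \<exists>a b. (v, a) \<in> E \<and> (v, b) \<in> E \<and> (a, b) \<in> E"
    and hv_unique: "\<lbrakk>hv v; (v, a) \<in> E; (v, b) \<in> E; hv a; hv b\<rbrakk> \<Longrightarrow> a = b"

locale picked_graph = saturated_graph +
  fixes P0 L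
  assumes P0_inner: "p \<in> P0 \<Longrightarrow> inner p"
    and P0_cover: "inner p \<Longrightarrow> \<exists>q\<in>P0. cnb p \<subseteq> cnb q"
    and P0_packing: "\<lbrakk>p \<in> P0; q \<in> P0; x \<in> cnb p; x \<in> cnb q\<rbrakk> \<Longrightarrow> p = q"
    and L_low: "x \<in> L \<Longrightarrow> low x"
    and L_tri_of: "\<lbrakk>x \<in> L; y \<in> L; tri_of x = tri_of y\<rbrakk> \<Longrightarrow> x = y"
    and L_out: "\<lbrakk>x \<in> L; y \<in> L; out x = out y\<rbrakk> \<Longrightarrow> x = y"
    and L_cover: "\<lbrakk>open_tri t; x \<in> t; y \<in> t; x \<noteq> y; low x; low y\<rbrakk> \<Longrightarrow> t \<inter> L \<noteq> {}"
    and L_max: "\<lbrakk>open_tri t; z \<in> t; low z; t \<inter> L = {}\<rbrakk> \<Longrightarrow> \<exists>x\<in>L. out x = out z"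
begin

definition special :: "'a set \<Rightarrow> bool" where
  "special t \<longleftrightarrow> open_tri t \<and> t \<inter> L = {}"

lemma low_openE:
  assumes "low x"
  obtains t where "open_tri t" "x \<in> t" "cnb x = insert (out x) t" "deg (out x) \<le> 2"
  using assms cnb_open unfolding low_def by blast

lemma P0_L_packing:
  assumes "p \<in> P0" "q \<in> L"
  shows "x \<notin> cnb p \<or> x \<notin> cnb q"
proof -
  obtain t where t: "open_tri t" "q \<in> t" "cnb q = insert (out q) t" "deg (out q) \<le> 2"
    using low_openE[OF L_low[OF assms(2)]] .
  have "inner p" using assms by (simp add: P0_inner)
  then show ?thesis
    using t open_tri_not_inner_cnb[OF t(1), of x p] out_not_inner_cnb[OF t(1,2,4), of p] by auto
qed

text \<open>Outer neighbours of low vertices have degree at most 2 and so lie in no open triangle.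
  The neighbourhoods could only meet in a common triangle or a common outer neighbour, and
  \<open>L\<close> repeats neither.\<close>

lemma L_packing:
  assumes "p \<in> L" "q \<in> L" "x \<in> cnb p" "x \<in> cnb q"
  shows "p = q"
proof -
  obtain t where t: "open_tri t" "p \<in> t" "cnb p = insert (out p) t" "deg (out p) \<le> 2"
    using low_openE[OF L_low[OF assms(1)]] .
  obtain s where s: "open_tri s" "q \<in> s" "cnb q = insert (out q) s" "deg (out q) \<le> 2"
    using low_openE[OF L_low[OF assms(2)]] .
  have "out p \<notin> s" using t(4) open_tri_nb(1)[OF s(1), of "out p"] by auto
  moreover have "out q \<notin> t" using s(4) open_tri_nb(1)[OF t(1), of "out q"] by auto
  ultimately have "out p = out q \<or> x \<in> t \<and> x \<in> s" using assms(3,4) t(3) s(3) by auto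
  then show ?thesis
  proof
    assume "x \<in> t \<and> x \<in> s"
    then have "t = s" using open_tri_unique t(1) s(1) by blast
    then have "tri_of p = tri_of q" using t s by (simp add: tri_of_eq)
    then show ?thesis using L_tri_of assms by blast
  qed (use L_out assms in blast)
qed

text \<open>Disjointness of closed neighbourhoods amounts to distance more than 2, as the third
  class requires.\<close>

lemma P_packing:
  assumes "p \<in> P0 \<union> L" "q \<in> P0 \<union> L" "x \<in> cnb p" "x \<in> cnb q"
  shows "p = q"
  using assms P0_packing[of p q x] L_packing[of p q x] P0_L_packing[of p q x] P0_L_packing[of q p x]
  by auto

text \<open>Two low vertices would make the triangle meet \<open>L\<close>. Without a low vertex,
  all three would be heavy, and each would have two heavy neighbours.\<close>

lemma special_shape:
  assumes "special t"
  obtains x y z where "t = {x, y, z}" "x \<noteq> y" "x \<noteq> z" "y \<noteq> z" "\<not> low x" "\<not> low y" "low z"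
    "(x, y) \<in> E" "(y, z) \<in> E" "(x, z) \<in> E"
proof -
  have t: "open_tri t" "t \<inter> L = {}" using assms by (auto simp: special_def)
  then have one: "a = b" if "a \<in> t" "b \<in> t" "low a" "low b" for a b
    using that L_cover[OF t(1)] by blast
  have "\<exists>z\<in>t. low z"
  proof (rule ccontr)
    assume neg: "\<not> ?thesis"
    obtain x where "x \<in> t" using t unfolding open_tri_def by blast
    then obtain y z where xyz: "t = {x, y, z}" "(x, y) \<in> E" "(y, z) \<in> E" "(x, z) \<in> E" "y \<noteq> z"
      using open_triE[OF t(1)] by metis
    then have "hv x" "hv y" "hv z" using neg high_hv(1)[OF t(1)] by auto
    with hv_unique[of x y z] xyz show False by blast
  qed
  then obtain z where z: "z \<in> t" "low z" by blast
  obtain x y where xy: "t = {z, x, y}" "(z, x) \<in> E" "(x, y) \<in> E" "(z, y) \<in> E"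
    "z \<noteq> x" "x \<noteq> y" "z \<noteq> y" using open_triE[OF t(1) z(1)] .
  have "\<not> low x" "\<not> low y" using one[of z x] one[of z y] z xy by auto
  moreover have "t = {x, y, z}" using xy(1) by auto
  ultimately show thesis using that[of x y z] xy z adj_sym by simp
qed

definition dart :: "'a \<Rightarrow> bool" where
  "dart x \<longleftrightarrow> (\<exists>t. special t \<and> x \<in> t) \<and> \<not> low x"

text \<open>A high vertex of a special triangle has a heavy neighbour in that triangle, so its outer
  neighbour is not heavy and thus lies in a triangle with a vertex of degree 2.\<close>

lemma dart_hub_exists:
  assumes "dart x"
  shows "\<exists>p\<in>P0. \<exists>b. E `` {out x} = {x, p, b} \<and> E `` {p} = {out x, b} \<and> x \<noteq> p \<and> b \<noteq> x \<and> b \<noteq> p"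
proof -
  obtain t where t: "special t" "x \<in> t" "\<not> low x" using assms unfolding dart_def by blast
  have ot: "open_tri t" using t(1) by (simp add: special_def)
  let ?w = "out x"
  note hx = high_hv[OF ot t(2,3)] and o = out_adj[OF ot t(2)] and nx = open_tri_nb[OF ot t(2)]
  have wx: "(?w, x) \<in> E" using o(1) by (rule adj_sym)
  obtain y where y: "y \<in> t" "y \<noteq> x" "\<not> low y" using special_shape[OF t(1)] t(2) by (metis insertCI)
  have "hv y" using high_hv(1)[OF ot] y by blast
  moreover have "(x, y) \<in> E" "y \<noteq> ?w" using nx y by auto
  ultimately have "\<not> hv ?w" using hv_unique[OF hx(1) o(1), of y] by blast
  then obtain a where a: "(?w, a) \<in> E" "deg a \<noteq> 3" using hx(2) by (auto simp: hv_def)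
  have ax: "a \<noteq> x" using a(2) nx(1) by blast
  \<comment> \<open>The edge from \<open>out x\<close> to \<open>x\<close> lies in no triangle, so
    the triangle at \<open>out x\<close> uses its other two neighbours, one of which is
    \<open>a\<close>.\<close>
  obtain c d where cd: "(?w, c) \<in> E" "(?w, d) \<in> E" "(c, d) \<in> E" using triangle[OF hx(2)] by blast
  have cdx: "c \<noteq> x" "d \<noteq> x" "c \<noteq> d" using cd o(2) adj_sym adj_irrefl by blast+
  have Nw': "E `` {?w} = {x, c, d}" using deg_eq_3I(2)[OF wx cd(1,2)] cdx by blast
  then have "a = c \<or> a = d" using a(1) ax by blast
  then obtain b where b: "E `` {?w} = {x, a, b}" "(a, b) \<in> E" "b \<noteq> a" "b \<noteq> x"
  proof
    assume "a = c"
    then show thesis using that[of d] Nw' cd(3) cdx by auto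
  next
    assume "a = d"
    then show thesis using that[of c] Nw' adj_sym[OF cd(3)] cdx by auto
  qed
  have wb: "(?w, b) \<in> E" using b(1) by blast
  have aw: "(a, ?w) \<in> E" using a(1) by (rule adj_sym)
  have "deg a \<le> 2" using a(2) deg_le[of a] by simp
  then have Na: "E `` {a} = {?w, b}"
    using nb_three[OF _ aw b(2)] aw b(2) wb adj_irrefl by blast
  have "inner a" unfolding inner_def
  proof (intro conjI allI impI)
    fix q assume "(a, q) \<in> E"
    then have "q = ?w \<or> q = b" using Na by blast
    then show "\<exists>c. (a, c) \<in> E \<and> (q, c) \<in> E" using aw b(2) wb adj_sym by blast
  qed (use aw in blast)
  then obtain p where p: "p \<in> P0" "cnb a \<subseteq> cnb p" using P0_cover by blast
  have "\<not> inner ?w" using o(2) wx adj_sym unfolding inner_def by blast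
  then have "p \<noteq> ?w" using P0_inner[OF p(1)] by blast
  moreover have "a \<in> cnb p" using p(2) by (auto simp: mem_cnb)
  then have "p = a \<or> (a, p) \<in> E" using adj_sym by (auto simp: mem_cnb)
  ultimately have "p = a \<or> p = b" using Na by blast
  then show ?thesis
  proof
    assume "p = a"
    then show ?thesis using p(1) b Na ax by blast
  next
    assume pb: "p = b"
    have ba: "(b, a) \<in> E" "(b, ?w) \<in> E" using b(2) wb adj_sym by blast+
    \<comment> \<open>The triangle on a further edge \<open>be\<close> would use \<open>a\<close> or
      \<open>out x\<close>, whose neighbourhoods only allow \<open>e = x\<close>. But then
      \<open>b\<close> would be a common neighbour of \<open>x\<close> and
      \<open>out x\<close>.\<close>
    have "e = a \<or> e = ?w" if e: "(b, e) \<in> E" for e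
    proof (rule ccontr)
      assume ne: "\<not> ?thesis"
      have "inner b" using pb p(1) P0_inner by blast
      then obtain c where c: "(b, c) \<in> E" "(e, c) \<in> E" "c \<noteq> b" "c \<noteq> e" using inner_common e by metis
      have aw_ne: "a \<noteq> ?w" using aw adj_irrefl by metis
      have "E `` {b} = {a, ?w, e}" using deg_eq_3I(2)[OF ba e] ne aw_ne by blast
      then have "c = a \<or> c = ?w" using c by blast
      then have "(a, e) \<in> E \<or> (?w, e) \<in> E" using adj_sym[OF c(2)] by blast
      then have "e \<in> {?w, b} \<or> e \<in> {x, a, b}" using Na b(1) by blast
      then have "e = x" using ne e adj_irrefl by auto
      then show False using o(2)[of b] e adj_sym wb by blast
    qed
    then have "E `` {b} = {?w, a}" using ba by blast
    moreover have "E `` {?w} = {x, b, a}" using b(1) by blast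
    ultimately show ?thesis using p(1) pb b ax by (intro bexI[of _ b] exI[of _ a]) auto
  qed
qed

text \<open>The hub has degree 2 and thus determines the triangle at \<open>out x\<close>, so it can
  stand for this triangle as \<beta> in the second injective choice.\<close>

definition hub :: "'a \<Rightarrow> 'a" where
  "hub x = (SOME p. p \<in> P0 \<and> (\<exists>b. E `` {out x} = {x, p, b} \<and> E `` {p} = {out x, b} \<and>
     x \<noteq> p \<and> b \<noteq> x \<and> b \<noteq> p))"

lemma hubE:
  assumes "dart x"
  obtains b where "hub x \<in> P0" "E `` {out x} = {x, hub x, b}" "E `` {hub x} = {out x, b}"
    "x \<noteq> hub x" "b \<noteq> x" "b \<noteq> hub x"
proof -
  have "\<exists>p. p \<in> P0 \<and> (\<exists>b. E `` {out x} = {x, p, b} \<and> E `` {p} = {out x, b} \<and>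
     x \<noteq> p \<and> b \<noteq> x \<and> b \<noteq> p)" using dart_hub_exists[OF assms] by blast
  from someI_ex[OF this] show thesis using that unfolding hub_def by blast
qed

lemma dart_openE:
  assumes "dart x"
  obtains t where "special t" "open_tri t" "x \<in> t" "\<not> low x"
  using assms unfolding dart_def special_def by blast

text \<open>All neighbours of \<open>out x\<close> other than \<open>x\<close> lie in the closed
  neighbourhood of the inner vertex \<open>hub x\<close>, which no open triangle meets.\<close>

lemma dart_eqI:
  assumes x: "dart x" and y: "dart y" and eq: "out x = out y"
  shows "x = y"
proof (rule ccontr)
  assume ne: "x \<noteq> y"
  obtain t where t: "special t" "open_tri t" "x \<in> t" "\<not> low x" using dart_openE[OF x] .
  obtain s where s: "special s" "open_tri s" "y \<in> s" "\<not> low y" using dart_openE[OF y] .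
  obtain b where b: "hub x \<in> P0" "E `` {out x} = {x, hub x, b}" "E `` {hub x} = {out x, b}"
    using hubE[OF x] by metis
  have "y \<in> E `` {out x}" using out_adj(1)[OF s(2,3)] eq adj_sym by auto
  then have "y = hub x \<or> y = b" unfolding b(2) using ne by simp
  moreover have "(hub x, b) \<in> E" using b(3) by blast
  ultimately have "y \<in> cnb (hub x)" by (auto simp: mem_cnb)
  then show False using open_tri_not_inner_cnb[OF s(2,3)] P0_inner[OF b(1)] by blast
qed

text \<open>Each special triangle has two darts by \<open>special_shape\<close>. A hub has just two
  neighbours, each the outer neighbour of at most one dart, so at most two darts share it.\<close>

lemma special_representatives_exist:
  obtains R where "\<And>x. x \<in> R \<Longrightarrow> dart x" "\<And>t. special t \<Longrightarrow> t \<inter> R \<noteq> {}"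
    "\<And>x y. \<lbrakk>x \<in> R; y \<in> R; hub x = hub y\<rbrakk> \<Longrightarrow> x = y"
    "\<And>x y. \<lbrakk>x \<in> R; y \<in> R; tri_of x = tri_of y\<rbrakk> \<Longrightarrow> x = y"
proof -
  have tri: "tri_of x = t" if "special t" "x \<in> t" for t x
    using that tri_of_eq by (simp add: special_def)
  have "Collect special \<subseteq> Pow V"
    using E_subset unfolding special_def open_tri_def by auto
  then have "finite (Collect special)" using finite_V finite_subset by blast
  moreover have "\<exists>d\<in>Collect dart. \<exists>e\<in>Collect dart. d \<noteq> e \<and> tri_of d = a \<and> tri_of e = a"
    if "a \<in> Collect special" for a
  proof -
    have a: "special a" using that by simp
    obtain x y where "x \<in> a" "y \<in> a" "x \<noteq> y" "\<not> low x" "\<not> low y"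
      using special_shape[OF a] by (metis insertCI)
    then show ?thesis using a tri[OF a] unfolding dart_def
      by (intro bexI[of _ x] bexI[of _ y]) auto
  qed
  moreover have "d = e \<or> e = f \<or> d = f"
    if "d \<in> Collect dart" "e \<in> Collect dart" "f \<in> Collect dart" "hub d = hub e" "hub e = hub f" for d e f
  proof -
    have m: "out g \<in> E `` {hub g}" if "dart g" for g using hubE[OF that] by blast
    have dd: "dart d" using that by simp
    obtain b where "E `` {hub d} = {out d, b}" using hubE[OF dd] by metis
    then have "out e \<in> {out d, b}" "out f \<in> {out d, b}" using m[of e] m[of f] that by auto
    then have "out d = out e \<or> out e = out f \<or> out d = out f" by auto
    then show ?thesis using dart_eqI that by blast
  qed
  ultimately have "\<exists>c. (\<forall>a\<in>Collect special. c a \<in> Collect dart \<and> tri_of (c a) = a) \<and>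
      inj_on (hub \<circ> c) (Collect special)"
    by (rule injective_dart_choice)
  then obtain c where c: "\<And>a. special a \<Longrightarrow> dart (c a) \<and> tri_of (c a) = a"
    and inj: "inj_on (hub \<circ> c) (Collect special)" by blast
  have mem: "c a \<in> a" if a: "special a" for a
  proof -
    obtain t where "special t" "c a \<in> t" using c[OF a] unfolding dart_def by blast
    then show ?thesis using tri c[OF a] by metis
  qed
  show thesis
  proof (rule that[of "c ` Collect special"])
    show "dart x" if "x \<in> c ` Collect special" for x using that c by blast
    show "t \<inter> c ` Collect special \<noteq> {}" if "special t" for t using that mem by blast
    show "x = y" if "x \<in> c ` Collect special" "y \<in> c ` Collect special" "hub x = hub y" for x y
      using that inj by (auto simp: inj_on_def)
    show "x = y" if "x \<in> c ` Collect special" "y \<in> c ` Collect special" "tri_of x = tri_of y" for x y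
      using that c by auto
  qed
qed

end

section \<open>The remaining graph and distances to its odd cycles\<close>

locale packed_graph = picked_graph +
  fixes R
  assumes R_dart: "x \<in> R \<Longrightarrow> dart x"
    and R_cover: "special t \<Longrightarrow> t \<inter> R \<noteq> {}"
    and R_hub: "\<lbrakk>x \<in> R; y \<in> R; hub x = hub y\<rbrakk> \<Longrightarrow> x = y"
    and R_tri_of: "\<lbrakk>x \<in> R; y \<in> R; tri_of x = tri_of y\<rbrakk> \<Longrightarrow> x = y"
begin

text \<open>The vertices picked from odd cycles still belong to \<open>Q\<close>; they are removed
  only in \<open>packing_color_if_representatives\<close>.\<close>

definition Q :: "'a set" where
  "Q = V - (P0 \<union> L) - R"

lemma P_not_adj: "p \<in> P0 \<union> L \<Longrightarrow> (p, q) \<in> E \<Longrightarrow> q \<notin> P0 \<union> L"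
  using P_packing[of p q q] adj_irrefl by (auto simp: mem_cnb)

text \<open>Otherwise the closed neighbourhood of \<open>v\<close> lies in \<open>Q\<close>. A
  triangle at \<open>v\<close> with an inner vertex puts a member of \<open>P0\<close> into that
  neighbourhood; an open one contains a member of \<open>L\<close> or \<open>R\<close>.\<close>

lemma Q_deg:
  assumes "v \<in> Q" "a \<in> Q" "b \<in> Q" "c \<in> Q" "(v, a) \<in> E" "(v, b) \<in> E" "(v, c) \<in> E"
  shows "a = b \<or> b = c \<or> a = c"
proof (rule ccontr)
  assume "\<not> ?thesis"
  then have d: "deg v = 3" "E `` {v} = {a, b, c}" using deg_eq_3I[OF assms(5,6,7)] by auto
  have nQ: "u \<in> Q" if "u = v \<or> (v, u) \<in> E" for u
  proof (cases "u = v")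
    case False
    then have "u \<in> E `` {v}" using that by simp
    then show ?thesis unfolding d(2) using assms by auto
  qed (use assms in simp)
  obtain d e where de: "(v, d) \<in> E" "(v, e) \<in> E" "(d, e) \<in> E" using triangle[OF d(1)] by blast
  let ?T = "{v, d, e}"
  have TQ: "?T \<subseteq> Q" using nQ de by auto
  show False
  proof (cases "\<exists>q\<in>?T. inner q")
    case True
    then obtain q where q: "q \<in> ?T" "inner q" by blast
    then have "v \<in> cnb q" using de adj_sym by (auto simp: mem_cnb)
    moreover obtain p where p: "p \<in> P0" "cnb q \<subseteq> cnb p" using P0_cover[OF q(2)] by blast
    ultimately have "v \<in> cnb p" by blast
    then have "p = v \<or> (v, p) \<in> E" using adj_sym by (auto simp: mem_cnb)
    then show False using nQ p(1) unfolding Q_def by blast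
  next
    case False
    then have "open_tri ?T" using de unfolding open_tri_def by blast
    then have "?T \<inter> L \<noteq> {} \<or> ?T \<inter> R \<noteq> {}" using R_cover unfolding special_def by blast
    then show False using TQ unfolding Q_def by blast
  qed
qed

sublocale rings: max_degree_two E Q
proof
  show "finite Q" using finite_V by (simp add: Q_def)
qed (fact adj_sym adj_irrefl Q_deg)+

lemma ring_nb:
  assumes "ring_in E Q Z" "v \<in> Z" "E `` {v} \<subseteq> {a, b, c}" "a \<notin> Z"
  shows "b \<in> Z" "c \<in> Z"
proof -
  obtain d e where "d \<in> Z" "e \<in> Z" "d \<noteq> e" "(v, d) \<in> E" "(v, e) \<in> E"
    using ring_in_two[OF assms(1,2)] .
  with assms(3,4) show "b \<in> Z" "c \<in> Z" by blast+
qed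

lemma ring_not_P: "ring_in E Q Z \<Longrightarrow> z \<in> Z \<Longrightarrow> z \<notin> P0 \<union> L \<and> z \<notin> R"
  using ring_in_subset unfolding Q_def by blast

lemma dart_out_cnb:
  assumes "dart x"
  shows "out x \<in> cnb (hub x)" "(out x, v) \<in> E \<Longrightarrow> v = x \<or> v \<in> cnb (hub x)"
proof -
  obtain b where b: "E `` {out x} = {x, hub x, b}" "E `` {hub x} = {out x, b}"
    using hubE[OF assms] by metis
  show "out x \<in> cnb (hub x)" using b(2) by (auto simp: cnb_def)
  assume "(out x, v) \<in> E"
  then have "v \<in> {x, hub x, b}" using b(1) by auto
  then show "v = x \<or> v \<in> cnb (hub x)" using b(2) by (auto simp: cnb_def)
qed

lemma hub_inner: "dart x \<Longrightarrow> inner (hub x)" and hub_P0: "dart x \<Longrightarrow> hub x \<in> P0"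
  using hubE P0_inner by metis+

text \<open>Two neighbours of \<open>out x\<close>, namely \<open>x\<close> and
  \<open>hub x\<close>, are outside \<open>Q\<close>, which leaves only one for the ring.\<close>

lemma dart_out_not_ring:
  assumes "x \<in> R" "ring_in E Q Z"
  shows "out x \<notin> Z"
proof
  assume z: "out x \<in> Z"
  note dx = R_dart[OF assms(1)]
  obtain b where b: "E `` {out x} = {x, hub x, b}" using hubE[OF dx] by metis
  have "x \<notin> Z" using assms ring_not_P by blast
  then have "hub x \<in> Z" using ring_nb(1)[OF assms(2) z, of x "hub x" b] b by simp
  then show False using hub_P0[OF dx] ring_not_P[OF assms(2)] by blast
qed

text \<open>One of the at most two neighbours of \<open>out z\<close> is in \<open>L\<close>. This
  serves \<open>z\<close> in \<open>L\<close> itself and, through \<open>L_max\<close>, the low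
  vertices of special triangles.\<close>

lemma low_out_not_ring:
  assumes "low z" "x \<in> L" "out x = out z" "ring_in E Q Z"
  shows "out z \<notin> Z"
proof
  assume u: "out z \<in> Z"
  obtain c d where cd: "c \<in> Z" "d \<in> Z" "c \<noteq> d" "(out z, c) \<in> E" "(out z, d) \<in> E"
    using ring_in_two[OF assms(4) u] .
  have "low x" using assms(2) by (rule L_low)
  then have "(out z, x) \<in> E" using assms(3) out_adj(1) adj_sym unfolding low_def by metis
  moreover have "deg (out z) \<le> 2" using assms(1) by (simp add: low_def)
  ultimately have "x = c \<or> x = d" using nb_three cd by metis
  then show False using cd assms(2) ring_not_P[OF assms(4)] by blast
qed

text \<open>The vertices drop out in turn: the representative \<open>x\<close>, then the low vertex
  \<open>z\<close>, which loses \<open>x\<close> and \<open>out z\<close>, then the third vertex,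
  which loses \<open>x\<close> and \<open>z\<close>.\<close>

lemma special_not_ring:
  assumes "special t" "ring_in E Q Z"
  shows "t \<inter> Z = {}"
proof -
  have ot: "open_tri t" "t \<inter> L = {}" using assms by (auto simp: special_def)
  obtain x where x: "x \<in> t" "x \<in> R" using R_cover[OF assms(1)] by blast
  have xZ: "x \<notin> Z" using x ring_not_P[OF assms(2)] by blast
  obtain z where z: "z \<in> t" "low z" using special_shape[OF assms(1)] by (metis insertCI)
  have xz: "x \<noteq> z" using z(2) R_dart[OF x(2)] unfolding dart_def by blast
  obtain u where "u \<in> L" "out u = out z" using L_max[OF ot(1) z ot(2)] by blast
  then have oz: "out z \<notin> Z" using low_out_not_ring z(2) assms(2) by blast
  obtain y where t: "t = {x, y, z}"
  proof -
    obtain a b where "t = {x, a, b}" using open_triE[OF ot(1) x(1)] by metis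
    then show thesis using that[of a] that[of b] z(1) xz by auto
  qed
  have zZ: "z \<notin> Z"
  proof
    assume "z \<in> Z"
    moreover have "E `` {z} \<subseteq> {out z, x, y}" using open_tri_nb(2)[OF ot(1) z(1)] t by auto
    ultimately show False using ring_nb(1)[OF assms(2)] oz xZ by blast
  qed
  have "y \<notin> Z"
  proof
    assume y: "y \<in> Z"
    have "y \<in> t" using t by simp
    then have "E `` {y} \<subseteq> {x, z, out y}" using open_tri_nb(2)[OF ot(1)] t by auto
    then show False using ring_nb(1)[OF assms(2) y] zZ xZ by blast
  qed
  with xZ zZ t show ?thesis by blast
qed

text \<open>The ring is closed in \<open>Q\<close>, so only \<open>R\<close> has to be excluded. The
  neighbours of a member of \<open>R\<close> lie in its special triangle or are its outer neighbour,
  and both avoid rings.\<close>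

lemma ring_exit:
  assumes "ring_in E Q Z" "v \<in> Z" "(v, q) \<in> E" "q \<notin> Z"
  shows "q \<in> P0 \<union> L"
proof (rule ccontr)
  assume "\<not> ?thesis"
  moreover have "q \<in> V" using assms(3) E_subset by blast
  moreover have "q \<notin> Q" using ring_in_closed[OF assms(1,2) _ assms(3)] assms(4) by blast
  ultimately have q: "q \<in> R" unfolding Q_def by blast
  obtain t where t: "special t" "open_tri t" "q \<in> t" using dart_openE[OF R_dart[OF q]] by metis
  have "v \<in> insert (out q) (t - {q})"
    using open_tri_nb(2)[OF t(2,3)] adj_sym[OF assms(3)] by auto
  then show False
    using dart_out_not_ring[OF q assms(1)] special_not_ring[OF t(1) assms(1)] assms(2) by blast
qed

text \<open>For \<open>p\<close> in \<open>P0\<close>, if \<open>x\<close> and \<open>x'\<close> are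
  neither equal nor adjacent, the degree of \<open>p\<close> makes one vertex complete the triangles
  on \<open>px\<close> and \<open>px'\<close>; it joins \<open>x\<close> to \<open>x'\<close> inside
  the ring. For \<open>p\<close> in \<open>L\<close>, both lie in the open triangle of
  \<open>p\<close>, as \<open>out p\<close> is on no ring.\<close>

lemma ring_through_P:
  assumes Z: "ring_in E Q Z" "ring_in E Q Z'" and x: "x \<in> Z" "x' \<in> Z'"
    and p: "p \<in> P0 \<union> L" "(p, x) \<in> E" "(p, x') \<in> E"
  shows "x' \<in> Z"
proof -
  have x'Q: "x' \<in> Q" using x(2) ring_in_subset[OF Z(2)] by blast
  note cl = ring_in_closed[OF Z(1) _ x'Q]
  show ?thesis
  proof (cases "x = x' \<or> (x, x') \<in> E")
    case True
    then show ?thesis using x(1) cl by blast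
  next
    case ne: False
    show ?thesis
    proof (cases "p \<in> P0")
      case True
      then have inn: "inner p" by (rule P0_inner)
      obtain c where c: "(p, c) \<in> E" "(x, c) \<in> E" "c \<noteq> p" "c \<noteq> x" using inner_common[OF inn p(2)] .
      obtain d where d: "(p, d) \<in> E" "(x', d) \<in> E" "d \<noteq> p" "d \<noteq> x'" using inner_common[OF inn p(3)] .
      have "c \<noteq> x'" "d \<noteq> x" using ne c d adj_sym by blast+
      then have "c = d" using nb_four[OF p(2,3) c(1) d(1)] ne c d by blast
      moreover have "c \<in> Z"
        using ring_exit[OF Z(1) x(1) c(2)] P_not_adj[OF p(1) c(1)] by blast
      ultimately show ?thesis using cl adj_sym[OF d(2)] by blast
    next
      case False
      then have pL: "p \<in> L" using p(1) by blast
      obtain t where t: "open_tri t" "p \<in> t" "deg (out p) \<le> 2"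
        using low_openE[OF L_low[OF pL]] by metis
      have oZ: "out p \<notin> Y" if Y: "ring_in E Q Y" for Y
        using low_out_not_ring[OF L_low[OF pL] pL refl Y] .
      have "x \<in> insert (out p) (t - {p})" "x' \<in> insert (out p) (t - {p})"
        using open_tri_nb(2)[OF t(1,2)] p(2,3) by auto
      then have "x \<in> t" "x' \<in> t" using oZ Z x by blast+
      then have "(x, x') \<in> E" using open_tri_nb(2)[OF t(1), of x] ne by auto
      with ne show ?thesis by blast
    qed
  qed
qed

text \<open>A walk of length at most 4 leaves \<open>Z\<close> to a vertex \<open>q\<close> of the
  third class and enters \<open>Z'\<close> from such a vertex \<open>q'\<close>. These are at
  distance at most 2, hence equal, against \<open>ring_through_P\<close>.\<close>

lemma ring_ring_far:
  assumes "ring_in E Q Z" "ring_in E Q Z'" "Z \<inter> Z' = {}" "r \<in> Z" "r' \<in> Z'"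
  shows "\<not> near E 4 r r'"
proof
  assume "near E 4 r r'"
  then have n: "near E (Suc 3) r r'" by (simp add: eval_nat_numeral)
  have "r' \<notin> Z" using assms by blast
  from near_exit[OF n assms(4) this]
  obtain x q where x: "x \<in> Z" "q \<notin> Z" "(x, q) \<in> E" "near E 3 q r'" by blast
  have q: "q \<in> P0 \<union> L" using ring_exit[OF assms(1)] x by blast
  then have qZ': "q \<notin> Z'" using ring_not_P[OF assms(2)] by blast
  have n': "near E (Suc 2) r' q" using near_sym[OF x(4)] adj_sym by (simp add: eval_nat_numeral)
  from near_exit[OF n' assms(5) qZ']
  obtain x' q' where x': "x' \<in> Z'" "q' \<notin> Z'" "(x', q') \<in> E" "near E 2 q' q" by blast
  have q': "q' \<in> P0 \<union> L" using ring_exit[OF assms(2)] x' by blast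
  have "near E (Suc (Suc 0)) q' q" using x'(4) by (simp add: eval_nat_numeral)
  then have "\<exists>m. m \<in> cnb q' \<and> m \<in> cnb q"
    using adj_sym by (auto simp: near_Suc mem_cnb)
  then have "q = q'" using P_packing q q' by blast
  then have "x' \<in> Z" using ring_through_P[OF assms(1,2) x(1) x'(1) q] x(3) x'(3) adj_sym by blast
  with x'(1) assms(3) show False by blast
qed

text \<open>A low outer neighbour is also adjacent to a member of \<open>L\<close>, by maximality,
  and a high one to a hub; members of the third class are not adjacent to each other.\<close>

lemma special_not_P:
  assumes "special t" "m \<in> t"
  shows "m \<notin> P0 \<union> L" "out m \<notin> P0 \<union> L"
proof -
  have ot: "open_tri t" "t \<inter> L = {}" using assms by (auto simp: special_def)
  then show "m \<notin> P0 \<union> L" using assms(2) P0_inner unfolding open_tri_def by blast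
  show "out m \<notin> P0 \<union> L"
  proof (cases "low m")
    case True
    then obtain u where u: "u \<in> L" "out u = out m" using L_max[OF ot(1) assms(2) _ ot(2)] by blast
    then obtain s where "open_tri s" "u \<in> s" using L_low unfolding low_def by blast
    then show ?thesis using out_adj(1) u P_not_adj[of u "out m"] by (metis UnI2)
  next
    case False
    then have d: "dart m" using assms unfolding dart_def by blast
    obtain b where "E `` {hub m} = {out m, b}" using hubE[OF d] by metis
    then have "(hub m, out m) \<in> E" by blast
    then show ?thesis using P_not_adj hub_P0[OF d] by blast
  qed
qed

text \<open>A short walk would leave the ring to a vertex \<open>q\<close> of the third class
  adjacent to the closed neighbourhood of \<open>x\<close>, which forces \<open>q = hub x\<close>.
  The ring would then contain \<open>b\<close> and, being closed in \<open>Q\<close>, also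
  \<open>out x\<close>.\<close>

lemma R_ring_far:
  assumes "ring_in E Q Z" "r \<in> Z" "x \<in> R"
  shows "\<not> near E 3 r x"
proof
  assume "near E 3 r x"
  then have n: "near E (Suc 2) r x" by (simp add: eval_nat_numeral)
  have xZ: "x \<notin> Z" using ring_not_P[OF assms(1)] assms(3) by blast
  from near_exit[OF n assms(2) xZ]
  obtain v q where v: "v \<in> Z" "q \<notin> Z" "(v, q) \<in> E" "near E 2 q x" by blast
  have q: "q \<in> P0 \<union> L" using ring_exit[OF assms(1)] v by blast
  note dx = R_dart[OF assms(3)]
  obtain t where t: "special t" "open_tri t" "x \<in> t" using dart_openE[OF dx] by metis
  obtain b where b: "E `` {out x} = {x, hub x, b}" "E `` {hub x} = {out x, b}"
    using hubE[OF dx] by metis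
  have b': "(out x, b) \<in> E" "(hub x, b) \<in> E" using b by auto
  have nP: "m \<notin> P0 \<union> L" if "m \<in> cnb x" for m
    using that special_not_P[OF t(1)] t(3) unfolding cnb_open[OF t(2,3)] by blast
  have "near E (Suc (Suc 0)) q x" using v(4) by (simp add: eval_nat_numeral)
  then obtain m where m: "m \<in> cnb x" "m = q \<or> (m, q) \<in> E"
    using adj_sym by (auto simp: near_Suc mem_cnb)
  then have mq: "(m, q) \<in> E" using nP q by blast
  have "q = hub x"
  proof (cases "m = out x")
    case True
    then have "q \<in> {x, hub x, b}" using mq b(1) by auto
    moreover have "q \<noteq> x" using nP[of x] q by (auto simp: mem_cnb)
    moreover have "q \<noteq> b" using P_not_adj[of "hub x" b] hub_P0[OF dx] b'(2) q by blast
    ultimately show ?thesis by blast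
  next
    case False
    then have "m \<in> t" using m(1) cnb_open[OF t(2,3)] by blast
    then have "q \<in> insert (out m) (t - {m})" using open_tri_nb(2)[OF t(2)] mq by auto
    then show ?thesis using special_not_P[OF t(1)] \<open>m \<in> t\<close> q by blast
  qed
  then have "v \<in> {out x, b}" using adj_sym[OF v(3)] b(2) by auto
  moreover have oZ: "out x \<notin> Z" using dart_out_not_ring[OF assms(3,1)] .
  ultimately have "b \<in> Z" using v(1) by blast
  moreover have "out x \<notin> R"
  proof
    assume "out x \<in> R"
    then obtain s where "open_tri s" "out x \<in> s" using dart_openE[OF R_dart] by metis
    then show False using open_tri_not_inner_cnb hub_inner[OF dx] dart_out_cnb(1)[OF dx] by blast
  qed
  then have "out x \<in> Q"
    using special_not_P(2)[OF t(1,3)] b'(1) E_subset unfolding Q_def by blast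
  ultimately have "out x \<in> Z" using ring_in_closed[OF assms(1)] adj_sym[OF b'(1)] by blast
  with oZ show False ..
qed

text \<open>At distance at most 3 the closed neighbourhoods meet or are joined by an edge. Adjacent
  outer neighbours would share their hub, against the injective choice; the other cases would put a
  vertex of an open triangle next to or at an inner vertex.\<close>

lemma R_R_far:
  assumes "x \<in> R" "y \<in> R" "x \<noteq> y"
  shows "\<not> near E 3 x y"
proof
  assume "near E 3 x y"
  note dx = R_dart[OF assms(1)] and dy = R_dart[OF assms(2)]
  obtain t where t: "special t" "open_tri t" "x \<in> t" using dart_openE[OF dx] by metis
  obtain s where s: "special s" "open_tri s" "y \<in> s" using dart_openE[OF dy] by metis
  have "t \<noteq> s" using R_tri_of[OF assms(1,2)] assms(3) t s by (auto simp: tri_of_eq)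
  then have dis: "a \<notin> s" if "a \<in> t" for a using that open_tri_unique t(2) s(2) by blast
  have "near E (Suc (Suc (Suc 0))) x y" using \<open>near E 3 x y\<close> by (simp add: eval_nat_numeral)
  then obtain a b where ab: "a \<in> cnb x" "b \<in> cnb y" "a = b \<or> (a, b) \<in> E"
    using adj_sym by (auto simp: near_Suc mem_cnb)
  \<comment> \<open>The vertex \<open>out u\<close> and its neighbours other than \<open>u\<close>
    lie in the closed neighbourhood of the inner vertex \<open>hub u\<close>.\<close>
  have hub_out: "a \<noteq> b \<and> (a, b) \<notin> E" if "dart u" "a = out u" "open_tri r" "b \<in> r" "u \<notin> r" for a b u r
  proof -
    have "b \<notin> cnb (hub u)" using open_tri_not_inner_cnb that hub_inner by blast
    then show ?thesis using dart_out_cnb[OF that(1)] that by blast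
  qed
  have "a \<in> insert (out x) t" "b \<in> insert (out y) s"
    using ab cnb_open t(2,3) s(2,3) by blast+
  then consider "a = out x" "b = out y" | "a = out x" "b \<in> s" | "a \<in> t" "b = out y" | "a \<in> t" "b \<in> s"
    by blast
  then show False
  proof cases
    case 1
    have "out x \<noteq> out y" using dart_eqI[OF dx dy] assms(3) by blast
    then have e: "(out x, out y) \<in> E" using ab(3) 1 by blast
    have "out y \<noteq> x"
      using dart_out_cnb(1)[OF dy] open_tri_not_inner_cnb[OF t(2,3)] hub_inner[OF dy] by metis
    then have "out y \<in> cnb (hub x)" using dart_out_cnb(2)[OF dx e] by blast
    then have "hub x = hub y" using P0_packing[of "hub x" "hub y"] hub_P0 dx dy dart_out_cnb(1)[OF dy] by blast
    then show False using R_hub assms by blast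
  next
    case 2
    then show False using hub_out[OF dx 2(1) s(2) 2(2)] dis[OF t(3)] ab(3) by blast
  next
    case 3
    then show False using hub_out[OF dy 3(2) t(2) 3(1)] dis s(3) ab(3) adj_sym by blast
  next
    case 4
    then have e: "(a, b) \<in> E" using ab(3) dis by blast
    have "b \<notin> t" using dis 4 by blast
    then have b: "b = out a" using open_tri_nb(2)[OF t(2) 4(1)] e by auto
    have "deg b = 3" using open_tri_nb(1)[OF s(2) 4(2)] .
    \<comment> \<open>Since \<open>b = out a\<close> lies in an open triangle, it has degree 3, so
      \<open>a\<close> is not low.\<close>
    then have "dart a" using t 4 b unfolding dart_def low_def by auto
    then have "inner (hub a)" "b \<in> cnb (hub a)" using hub_inner dart_out_cnb(1) b by auto
    then show False using open_tri_not_inner_cnb[OF s(2) 4(2)] by blast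
  qed
qed

section \<open>Assembling the colouring\<close>

text \<open>The last class is \<open>R\<close> with one vertex per odd ring. Pairs involving
  \<open>R\<close> are only known to have distance more than 3, while two ring vertices have
  distance more than 4; hence \<open>s = 4\<close> is claimed only for empty
  \<open>R\<close>.\<close>

lemma packing_color_if_representatives:
  assumes "s = 3 \<or> s = 4 \<and> R = {}"
  shows "\<exists>f :: 'a \<Rightarrow> nat. \<forall>u\<in>V. f u < 4 \<and>
    (\<forall>v\<in>V. u \<noteq> v \<longrightarrow> f u = f v \<longrightarrow> \<not> near E ([1, 1, 2, s] ! f u) u v)"
proof -
  obtain R1 where R1: "R1 \<subseteq> Q" "two_colorable E (Q - R1)"
    "\<And>r. r \<in> R1 \<Longrightarrow> \<exists>Z\<in>odd_rings E Q. r \<in> Z"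
    "\<And>r r' Z. \<lbrakk>r \<in> R1; r' \<in> R1; Z \<in> odd_rings E Q; r \<in> Z; r' \<in> Z\<rbrakk> \<Longrightarrow> r = r'"
  proof (rule rings.odd_ring_transversal)
    fix T assume a: "T \<subseteq> Q" "two_colorable E (Q - T)"
      "\<And>r. r \<in> T \<Longrightarrow> \<exists>Z\<in>odd_rings E Q. r \<in> Z"
      "\<And>r r' Z. \<lbrakk>r \<in> T; r' \<in> T; Z \<in> odd_rings E Q; r \<in> Z; r' \<in> Z\<rbrakk> \<Longrightarrow> r = r'"
    show thesis by (rule that[of T]) (fact a)+
  qed
  obtain c :: "'a \<Rightarrow> bool" where c: "\<And>x y. \<lbrakk>x \<in> Q - R1; y \<in> Q - R1; (x, y) \<in> E\<rbrakk> \<Longrightarrow> c x \<noteq> c y"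
    using R1(2) unfolding two_colorable_def by blast
  have ring: "ring_in E Q Z" if "Z \<in> odd_rings E Q" for Z
    using rings.odd_ring_ring_in[OF that] .
  have mono: "near E n u v" if "near E m u v" "m \<le> n" for m n u v
    using that unfolding near_def by (meson order_trans)
  define f :: "'a \<Rightarrow> nat" where
    "f v = (if v \<in> P0 \<union> L then 2 else if v \<in> R \<union> R1 then 3 else if c v then 1 else 0)" for v
  have far3: "\<not> near E s u v" if uv: "u \<in> R \<union> R1" "v \<in> R \<union> R1" "u \<noteq> v" for u v
  proof -
    have RR1: "\<not> near E s x r" "\<not> near E s r x" if xr: "x \<in> R" "r \<in> R1" for x r
    proof -
      obtain Z where "Z \<in> odd_rings E Q" "r \<in> Z" using R1(3) xr by blast
      then have n: "\<not> near E 3 r x" using R_ring_far ring xr by blast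
      have "s = 3" using assms xr by blast
      moreover have "near E 3 r x" if "near E 3 x r"
        using that by (rule near_sym) (rule adj_sym)
      ultimately show "\<not> near E s x r" "\<not> near E s r x" using n by auto
    qed
    have R1R1: "\<not> near E s r r'" if r: "r \<in> R1" "r' \<in> R1" "r \<noteq> r'" for r r'
    proof -
      obtain Z where Z: "Z \<in> odd_rings E Q" "r \<in> Z" using R1(3) r by blast
      obtain Z' where Z': "Z' \<in> odd_rings E Q" "r' \<in> Z'" using R1(3) r by blast
      have "Z \<noteq> Z'" using R1(4) r Z Z' by blast
      then have "Z \<inter> Z' = {}"
        using rings.odd_rings_disjoint[OF Z(1) Z'(1)] by blast
      then have "\<not> near E 4 r r'" using ring_ring_far ring Z Z' by blast
      then show ?thesis using assms mono[of s r r' 4] by auto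
    qed
    have RR: "\<not> near E s x y" if "x \<in> R" "y \<in> R" "x \<noteq> y" for x y
      using that assms R_R_far by blast
    from uv RR1 R1R1 RR show ?thesis by blast
  qed
  have far2: "\<not> near E 2 u v" if "u \<in> P0 \<union> L" "v \<in> P0 \<union> L" "u \<noteq> v" for u v
  proof
    assume "near E 2 u v"
    then have "near E (Suc (Suc 0)) u v" by (simp add: eval_nat_numeral)
    then have "\<exists>m. m \<in> cnb u \<and> m \<in> cnb v" using adj_sym by (auto simp: near_Suc mem_cnb)
    then show False using P_packing that by blast
  qed
  have far1: "\<not> near E 1 u v" if "u \<in> Q - R1" "v \<in> Q - R1" "u \<noteq> v" "c u = c v" for u v
  proof
    assume "near E 1 u v"
    then have "near E (Suc 0) u v" by simp
    then have "(u, v) \<in> E" using that by (auto simp: near_Suc)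
    then show False using c that by blast
  qed
  have "f u < 4 \<and> (\<forall>v\<in>V. u \<noteq> v \<longrightarrow> f u = f v \<longrightarrow> \<not> near E ([1, 1, 2, s] ! f u) u v)" if u: "u \<in> V" for u
  proof (intro conjI ballI impI)
    show "f u < 4" by (simp add: f_def)
    fix v assume v: "v \<in> V" "u \<noteq> v" "f u = f v"
    consider "u \<in> P0 \<union> L" | "u \<notin> P0 \<union> L" "u \<in> R \<union> R1" | "u \<notin> P0 \<union> L" "u \<notin> R \<union> R1" by blast
    then show "\<not> near E ([1, 1, 2, s] ! f u) u v"
    proof cases
      case 1
      then have "f u = 2" by (simp add: f_def)
      moreover from this have "v \<in> P0 \<union> L" using v(3) by (auto simp: f_def split: if_splits)
      ultimately show ?thesis using far2[OF 1 _ v(2)] by simp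
    next
      case 2
      then have "f u = 3" by (auto simp: f_def)
      moreover from this have "v \<in> R \<union> R1" using v(3) by (auto simp: f_def split: if_splits)
      ultimately show ?thesis using far3[OF 2(2) _ v(2)] by simp
    next
      case 3
      then have fu: "f u = (if c u then 1 else 0)" by (simp add: f_def)
      then have nv: "v \<notin> P0 \<union> L" "v \<notin> R \<union> R1" using v(3) by (auto simp: f_def split: if_splits)
      then have "f v = (if c v then 1 else 0)" by (simp add: f_def)
      then have cuv: "c u = c v" using fu v(3) by (cases "c u"; cases "c v") auto
      have "u \<in> Q - R1" "v \<in> Q - R1" using 3 nv u v(1) unfolding Q_def by blast+
      then have "\<not> near E 1 u v" using far1 v(2) cuv by blast
      then show ?thesis unfolding fu by simp
    qed
  qed
  then show ?thesis by blast
qed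

end

context saturated_graph begin

lemma packing_color_exists:
  assumes "s = 3 \<or> s = 4 \<and> (\<forall>u v. hv u \<longrightarrow> (u, v) \<in> E \<longrightarrow> \<not> hv v)"
  shows "\<exists>f :: 'a \<Rightarrow> nat. \<forall>u\<in>V. f u < 4 \<and>
    (\<forall>v\<in>V. u \<noteq> v \<longrightarrow> f u = f v \<longrightarrow> \<not> near E ([1, 1, 2, s] ! f u) u v)"
proof (rule inner_packing_exists)
  fix P0 assume P0: "\<And>p. p \<in> P0 \<Longrightarrow> inner p"
    "\<And>p. inner p \<Longrightarrow> \<exists>q\<in>P0. cnb p \<subseteq> cnb q"
    "\<And>p q x. \<lbrakk>p \<in> P0; q \<in> P0; x \<in> cnb p; x \<in> cnb q\<rbrakk> \<Longrightarrow> p = q"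
  show ?thesis
  proof (rule low_picks_exist)
    fix L assume L: "\<And>x. x \<in> L \<Longrightarrow> low x"
      "\<And>x y. \<lbrakk>x \<in> L; y \<in> L; tri_of x = tri_of y\<rbrakk> \<Longrightarrow> x = y"
      "\<And>x y. \<lbrakk>x \<in> L; y \<in> L; out x = out y\<rbrakk> \<Longrightarrow> x = y"
      "\<And>t x y. \<lbrakk>open_tri t; x \<in> t; y \<in> t; x \<noteq> y; low x; low y\<rbrakk> \<Longrightarrow> t \<inter> L \<noteq> {}"
      "\<And>t z. \<lbrakk>open_tri t; z \<in> t; low z; t \<inter> L = {}\<rbrakk> \<Longrightarrow> \<exists>x\<in>L. out x = out z"
    interpret picked_graph V E P0 L
      by unfold_locales (fact P0 L)+
    show ?thesis
    proof (rule special_representatives_exist)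
      fix R assume R: "\<And>x. x \<in> R \<Longrightarrow> dart x" "\<And>t. special t \<Longrightarrow> t \<inter> R \<noteq> {}"
        "\<And>x y. \<lbrakk>x \<in> R; y \<in> R; hub x = hub y\<rbrakk> \<Longrightarrow> x = y"
        "\<And>x y. \<lbrakk>x \<in> R; y \<in> R; tri_of x = tri_of y\<rbrakk> \<Longrightarrow> x = y"
      interpret packed_graph V E P0 L R
        by unfold_locales (fact R)+
      \<comment> \<open>A special triangle contains two adjacent heavy vertices, so without such a
        pair there is nothing to represent.\<close>
      have "R = {}" if nh: "\<forall>u v. hv u \<longrightarrow> (u, v) \<in> E \<longrightarrow> \<not> hv v"
      proof (rule ccontr)
        assume "R \<noteq> {}"
        then obtain t where t: "special t" using R(1) unfolding dart_def by blast
        obtain x y where xy: "x \<in> t" "y \<in> t" "\<not> low x" "\<not> low y" "(x, y) \<in> E"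
          using special_shape[OF t] by (metis insertCI)
        have "open_tri t" using t by (simp add: special_def)
        then have "hv x" "hv y" using high_hv(1) xy by blast+
        then show False using nh xy(5) by blast
      qed
      with assms show ?thesis by (intro packing_color_if_representatives) blast
    qed
  qed
qed

end

section \<open>Transfer to pair graphs\<close>

lemma (in pair_graph) degree_eq_card: "degree G v = card (parcs G `` {v})"
proof -
  have "out_arcs (with_proj G) v = Pair v ` (parcs G `` {v})" by (auto simp: out_arcs_def)
  then show ?thesis unfolding out_degree_def by (simp add: card_image inj_on_def)
qed

lemma (in pair_graph) awalk_relpow: "awalk u p v \<Longrightarrow> (u, v) \<in> parcs G ^^ length p"
proof (induction p arbitrary: u)
  case (Cons e p)
  then have "(u, snd e) \<in> parcs G" "(snd e, v) \<in> parcs G ^^ length p"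
    by (auto simp: awalk_Cons_iff)
  then show ?case by (simp add: relpow_commute[symmetric] relcomp.relcompI)
qed (simp add: awalk_Nil_iff)

lemma (in pair_graph) graph_dist_greater:
  assumes "\<not> near (parcs G) n u v"
  shows "graph_dist G u v > ereal (real n)"
proof -
  \<comment> \<open>The bound is \<open>Suc n\<close> because an infimum of costs exceeding
    \<open>n\<close> need not itself exceed \<open>n\<close>; the strict inequality comes from
    integrality.\<close>
  have "ereal (real (Suc n)) \<le> ereal (awalk_cost (\<lambda>_. 1) p)" if "awalk u p v" for p
  proof -
    have "\<not> length p \<le> n" using assms awalk_relpow[OF that] unfolding near_def by blast
    moreover have "awalk_cost (\<lambda>_. 1) p = real (length p)"
      by (simp add: awalk_cost_def sum_list_triv)
    ultimately show ?thesis by simp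
  qed
  then have "ereal (real (Suc n)) \<le> graph_dist G u v"
    unfolding graph_dist_def \<mu>_def by (auto intro!: INF_greatest)
  then show ?thesis by (rule less_le_trans[rotated]) simp
qed

lemma (in pair_graph) local_girth_3_triangle:
  assumes "local_girth G v \<le> 3"
  shows "\<exists>a b. (v, a) \<in> parcs G \<and> (v, b) \<in> parcs G \<and> (a, b) \<in> parcs G"
proof -
  have sym: "(y, x) \<in> parcs G" if "(x, y) \<in> parcs G" for x y
    using that pair_sym_arcs by (auto simp: symmetric_def dest: symD)
  obtain p where p: "cycle p" "3 \<le> length p" "v \<in> fst ` set p" "length p < 4"
  proof -
    \<comment> \<open>A strict bound on the infimum yields a cycle below it, here of length exactly
      3.\<close>
    have "local_girth G v < enat 4"
      using assms by (rule le_less_trans) (simp add: numeral_eq_enat)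
    then show thesis using that unfolding local_girth_def INF_less_iff by auto
  qed
  obtain u where u: "awalk u p u" using p(1) unfolding cycle_def by blast
  have "length p = Suc (Suc (Suc 0))" using p(2,4) by simp
  then obtain e f g where "p = [e, f, g]" by (auto simp: length_Suc_conv)
  with u have "e \<in> parcs G" "f \<in> parcs G" "g \<in> parcs G" "fst e = u" "snd e = fst f" "snd f = fst g"
    "snd g = u" "v = fst e \<or> v = fst f \<or> v = fst g"
    using p(3) by (auto simp: awalk_Cons_iff awalk_Nil_iff)
  then have "(u, fst f) \<in> parcs G" "(fst f, fst g) \<in> parcs G" "(fst g, u) \<in> parcs G"
    "v = u \<or> v = fst f \<or> v = fst g"
    by (metis prod.collapse)+
  then show ?thesis using sym by blast
qed

theorem theorem6:
  fixes G :: "'a pair_pre_digraph" and i :: nat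
  assumes "pair_graph G"
    and "i \<in> {0, 1}"
    and "subcubic G"
    and "saturated3 G i"
    and "g3 G = 3"
  shows "(i = 0 \<longrightarrow> packing_colorable G [1, 1, 2, 4]) \<and>
         (i = 1 \<longrightarrow> packing_colorable G [1, 1, 2, 3])"
proof -
  interpret G: pair_graph G by fact
  have inV: "u \<in> pverts G" "v \<in> pverts G" if "(u, v) \<in> parcs G" for u v
    using that G.in_arcsD1 G.in_arcsD2 by blast+
  interpret subcubic_graph "pverts G" "parcs G"
  proof
    show "finite (pverts G)" by (rule G.pair_finite_verts)
    show "parcs G \<subseteq> pverts G \<times> pverts G" using inV by auto
    show "(v, u) \<in> parcs G" if "(u, v) \<in> parcs G" for u v
      using that G.pair_sym_arcs by (auto simp: symmetric_def dest: symD)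
    show "(v, v) \<notin> parcs G" for v using G.pair_no_loops by fastforce
    show "card (parcs G `` {v}) \<le> 3" for v
    proof (cases "v \<in> pverts G")
      case True
      then show ?thesis using assms(3) unfolding subcubic_def by (simp add: G.degree_eq_card)
    next
      case False
      then have "parcs G `` {v} = {}" using inV by blast
      then show ?thesis by simp
    qed
  qed
  have deg: "degree G v = deg v" for v by (simp add: G.degree_eq_card deg_def)
  have deg3V: "v \<in> pverts G" if "deg v = 3" for v
  proof -
    have "parcs G `` {v} \<noteq> {}" using that unfolding deg_def by fastforce
    then show ?thesis using inV by blast
  qed
  have heavy: "heavy G v \<longleftrightarrow> hv v" for v
    using deg3V by (auto simp: heavy_def hv_def deg)
  have sat: "card {u. (v, u) \<in> parcs G \<and> hv u} \<le> i" if "hv v" for v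
    using that assms(4) unfolding saturated3_def heavy by blast
  \<comment> \<open>Finiteness matters because \<open>card\<close> of an infinite set is 0, so the
    saturation bound alone would not limit the set.\<close>
  have fin: "finite {u. (v, u) \<in> parcs G \<and> hv u}" for v
    by (rule finite_subset[OF _ finite_nb[of v]]) auto
  interpret saturated_graph "pverts G" "parcs G"
  proof
    fix v assume v: "deg v = 3"
    have "local_girth G v \<le> g3 G"
      unfolding g3_def using v deg3V by (intro SUP_upper) (simp add: deg)
    then show "\<exists>a b. (v, a) \<in> parcs G \<and> (v, b) \<in> parcs G \<and> (a, b) \<in> parcs G"
      using G.local_girth_3_triangle assms(5) by simp
  next
    fix v a b assume v: "hv v" "(v, a) \<in> parcs G" "(v, b) \<in> parcs G" "hv a" "hv b"
    have "card {a, b} \<le> card {u. (v, u) \<in> parcs G \<and> hv u}"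
      using v by (intro card_mono fin) auto
    also have "\<dots> \<le> 1" using sat[OF v(1)] assms(2) by auto
    finally show "a = b" by (cases "a = b") auto
  qed
  have colorable: "packing_colorable G [1, 1, 2, s]"
    if s: "s = 3 \<or> s = 4 \<and> (\<forall>u v. hv u \<longrightarrow> (u, v) \<in> parcs G \<longrightarrow> \<not> hv v)" for s
  proof -
    obtain f :: "'a \<Rightarrow> nat" where f: "\<And>u. u \<in> pverts G \<Longrightarrow> f u < 4"
      "\<And>u v. \<lbrakk>u \<in> pverts G; v \<in> pverts G; u \<noteq> v; f u = f v\<rbrakk> \<Longrightarrow>
        \<not> near (parcs G) ([1, 1, 2, s] ! f u) u v"
      using packing_color_exists[OF s] by blast
    have "packing_coloring G [1, 1, 2, s] (\<lambda>j. {v \<in> pverts G. f v = j})"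
      unfolding packing_coloring_def
    proof (intro conjI)
      show "(\<Union>j<length [1, 1, 2, s]. {v \<in> pverts G. f v = j}) = pverts G"
        using f(1) by (auto simp: eval_nat_numeral)
      show "disjoint_family_on (\<lambda>j. {v \<in> pverts G. f v = j}) {..<length [1, 1, 2, s]}"
        by (auto simp: disjoint_family_on_def)
      show "\<forall>j<length [1, 1, 2, s]. \<forall>u\<in>{v \<in> pverts G. f v = j}. \<forall>v\<in>{v \<in> pverts G. f v = j}.
          u \<noteq> v \<longrightarrow> graph_dist G u v > ereal (real ([1, 1, 2, s] ! j))"
      proof (intro allI ballI impI)
        fix j u v
        assume uv: "u \<in> {v \<in> pverts G. f v = j}" "v \<in> {v \<in> pverts G. f v = j}" "u \<noteq> v"
        then have "\<not> near (parcs G) ([1, 1, 2, s] ! j) u v" using f(2)[of u v] by simp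
        then show "graph_dist G u v > ereal (real ([1, 1, 2, s] ! j))" by (rule G.graph_dist_greater)
      qed
    qed
    then show ?thesis unfolding packing_colorable_def by blast
  qed
  \<comment> \<open>For \<open>i = 0\<close> no two heavy vertices are adjacent, which is the
    condition under which \<open>s = 4\<close> is available.\<close>
  have "\<not> hv v" if "i = 0" "hv u" "(u, v) \<in> parcs G" for u v
    using sat[OF that(2)] that fin[of u] by auto
  then show ?thesis using colorable by blast
qed

end
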